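(* Let $n\geq 1$ be an integer and let $R_n$ be the pyrene chain with $4n$ hexagons. Let $I,J,K\in\mathbb{Z}[x,y]$ be $I=x^{13}+4x^{12}+10x^{11}+20x^{10}+2x^9y+33x^9+8x^8y+46x^8+18x^7y+56x^7+x^6y^2+31x^6y+60x^6+6x^5y^2+42x^5y+56x^5+11x^4y^2+49x^4y+44x^4+2x^3y^3+17x^3y^2+44x^3y+29x^3+2x^2y^3+17x^2y^2+34x^2y+15x^2+4xy^3+17xy^2+19xy+4x+y^4+5y^3+8y^2+4y$, $J=x^2(x^{12}+3x^{11}+6x^{10}+10x^9+x^8y+14x^8+4x^7y+16x^7+7x^6y+16x^6+10x^5y+14x^5+2x^4y^2+11x^4y+10x^4+2x^3y^2+10x^3y+6x^3+3x^2y^2+7x^2y+3x^2+3xy^2+4xy+x+y^3+2y^2+y)$, $K=x^5(x^5+x^4+x^3+x^2+x+y)^2$, and put \begin{align*} A&=\frac{y((x-1)I-J)}{xy-x-y}, & C&=\frac{y((x-1)(I+J)-(J+K))}{xy-x-y},\\ B&=\frac{(y-1)J-I}{xy-x-y}, & D&=\frac{(y-1)(J+K)-(I+J)}{xy-x-y}, \end{align*} $$\lambda_{1,2}=\frac{A+D\pm\sqrt{(A-D)^2+4BC}}{2}.$$ Then the Tutte polynomial $T(R_n)=T(R_n;x,y)$ satisfies $$T(R_n)=(I+2J+K)\frac{\lambda^n_1-\lambda^n_2}{\lambda_1-\lambda_2}+\big(C(I+J)-A(I+2J+K)\big)\frac{\lambda^{n-1}_1-\lambda^{n-1}_2}{\lambda_1-\lambda_2},$$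 and equivalently \begin{align*} T(R_n)=&(I+2J+K)\sum_{j=0}^{\lfloor \frac{n-1}{2}\rfloor}\binom{n-j-1}{j}(A+D)^{n-2j-1}(BC-AD)^{j}\\ &+\big(C(I+J)-A(I+2J+K)\big)\sum_{j=0}^{\lfloor \frac{n-2}{2}\rfloor}\binom{n-j-2}{j}(A+D)^{n-2j-2}(BC-AD)^{j}. \end{align*}
   Context: The Tutte polynomial of a finite graph $G=(V,E)$ (loops and multiple edges allowed) is $T(G;x,y)=\sum_{S\subseteq E}(x-1)^{r(E)-r(S)}(y-1)^{|S|-r(S)}$, where $r(S)=|V|-\omega(V,S)$ and $\omega(V,S)$ is the number of connected components of $(V,S)$. A benzenoid system is a finite connected plane graph without cut vertices in which every interior face is bounded by a regular hexagon of side length $1$; two hexagons are adjacent if they share an edge. The pyrene chain $R_n$ is the benzenoid system with $4n$ hexagons $u_i,w_i,a_i,b_i$ ($1\le i\le n$) arranged as follows: $u_1,w_1,u_2,w_2,\dots,u_n,w_n$ form a straight linear row, in this order, consecutive ones sharing an edge; for each $i$, $a_i$ is the hexagon above the row adjacent to both $u_i$ and $w_i$, and $b_i$ is the hexagon below the row adjacent to both $u_i$ and $w_i$. The adjacent pairs are exactly $u_iw_i,\ u_ia_i,\ u_ib_i,\ w_ia_i,\ w_ib_i$ ($1\le i\le n$) and $w_iu_{i+1}$ ($1\le i\le n-1$). Thus $R_1$ is pyrene. Equivalently, the planar dual of $R_n$ has vertices $u_i,w_i,a_i,b_i$ and $v$ (the outer face), one edge for each adjacent pair listed, and edges to $v$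 with multiplicity $4$ from each $a_i$ and $b_i$, and multiplicity $2$ from each $u_i$ and $w_i$, except that $u_1$ and $w_n$ are joined to $v$ with multiplicity $3$. Identities are between elements of an algebraic closure of $\mathbb{Q}(x,y)$; empty sums are $0$. *)

theory Defs
  imports
    Complex_Main
    "HOL-Computational_Algebra.Polynomial_Factorial"
    "HOL-Algebra.Algebraic_Closure_Type"
begin

section \<open>Multigraphs and the Tutte polynomial\<close>

text \<open>The set of ends of an edge has two elements, or one if the edge is a loop; distinct edges
  may have the same ends.\<close>

record ('v, 'e) multigraph =
  verts :: "'v set"
  edges :: "'e set"
  ends :: "'e \<Rightarrow> 'v set"

definition finite_multigraph :: "('v, 'e) multigraph \<Rightarrow> bool" where
  "finite_multigraph G \<longleftrightarrow> finite (verts G) \<and> finite (edges G) \<and>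
     (\<forall>e\<in>edges G. \<exists>a\<in>verts G. \<exists>b\<in>verts G. ends G e = {a, b})"

definition joined :: "('v, 'e) multigraph \<Rightarrow> 'e set \<Rightarrow> ('v \<times> 'v) set" where
  "joined G S = {(u, v). u \<in> verts G \<and> v \<in> verts G \<and>
     (u, v) \<in> {(a, b). \<exists>e\<in>S. ends G e = {a, b}}\<^sup>*}"

definition num_components :: "('v, 'e) multigraph \<Rightarrow> 'e set \<Rightarrow> nat" where
  "num_components G S = card (verts G // joined G S)"

definition edge_rank :: "('v, 'e) multigraph \<Rightarrow> 'e set \<Rightarrow> nat" where
  "edge_rank G S = card (verts G) - num_components G S"

text \<open>The natural-number subtractions, here and in \<open>edge_rank\<close>, never truncate for a finite
  multigraph: there are at most as many components as vertices, the rank is monotone, and it is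
  bounded by the number of edges. The polynomial itself is the value at two indeterminates.\<close>

definition tutte :: "('v, 'e) multigraph \<Rightarrow> 'a :: comm_ring_1 \<Rightarrow> 'a \<Rightarrow> 'a" where
  "tutte G x y = (\<Sum>S\<in>Pow (edges G).
     (x - 1) ^ (edge_rank G (edges G) - edge_rank G S) * (y - 1) ^ (card S - edge_rank G S))"


section \<open>Hexagons\<close>

text \<open>Points of the plane are given by integer coordinates \<open>(p, q)\<close>, measured in the units
  \<open>sqrt 3 / 2\<close> horizontally and \<open>1 / 2\<close> vertically. A hexagon is represented by its centre; it is
  regular with side length 1 and has two vertical sides.\<close>

type_synonym point = "int \<times> int"

definition plane_point :: "point \<Rightarrow> complex" where
  "plane_point = (\<lambda>(p, q). Complex (sqrt 3 / 2 * of_int p) (of_int q / 2))"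

fun hexagon_corners :: "point \<Rightarrow> point set" where
  "hexagon_corners (p, q) =
     {(p, q + 2), (p + 1, q + 1), (p + 1, q - 1), (p, q - 2), (p - 1, q - 1), (p - 1, q + 1)}"

fun hexagon_sides :: "point \<Rightarrow> point set set" where
  "hexagon_sides (p, q) =
     {{(p, q + 2), (p + 1, q + 1)}, {(p + 1, q + 1), (p + 1, q - 1)},
      {(p + 1, q - 1), (p, q - 2)}, {(p, q - 2), (p - 1, q - 1)},
      {(p - 1, q - 1), (p - 1, q + 1)}, {(p - 1, q + 1), (p, q + 2)}}"

definition hexagon_graph :: "point set \<Rightarrow> (point, point set) multigraph" where
  "hexagon_graph H =
     \<lparr>verts = (\<Union>c\<in>H. hexagon_corners c), edges = (\<Union>c\<in>H. hexagon_sides c), ends = (\<lambda>e. e)\<rparr>"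

definition hexagons_adjacent :: "point \<Rightarrow> point \<Rightarrow> bool" where
  "hexagons_adjacent c d \<longleftrightarrow> c \<noteq> d \<and> hexagon_sides c \<inter> hexagon_sides d \<noteq> {}"

lemma inj_plane_point: "inj plane_point"
  by (auto simp: inj_def plane_point_def)

lemma hexagon_corner_dist:
  assumes "v \<in> hexagon_corners c"
  shows "dist (plane_point v) (plane_point c) = 1"
  using assms
  by (cases c) (auto simp: plane_point_def dist_norm cmod_def field_simps power2_eq_square)

lemma hexagon_side_length:
  assumes "{v, w} \<in> hexagon_sides c"
  shows "dist (plane_point v) (plane_point w) = 1"
  using assms
  by (cases c) (auto simp: doubleton_eq_iff plane_point_def dist_norm cmod_def field_simps
      power2_eq_square)

lemma hexagons_adjacent_iff:
  assumes "even (p' - p + (q' - q))"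
  shows "hexagons_adjacent (p, q) (p', q') \<longleftrightarrow>
     (p' - p, q' - q) \<in> {(2, 0), (1, 3), (-1, 3), (-2, 0), (-1, -3), (1, -3)}"
  (is "_ \<longleftrightarrow> ?R")
proof
  let ?M = "{(1, 3), (2, 0), (1, -3), (-1, -3), (-2, 0), (-1, 3)} :: point set"
  have M: "(sum fst e - 2 * a, sum snd e - 2 * b) \<in> ?M" if "e \<in> hexagon_sides (a, b)" for e a b
    using that unfolding hexagon_sides.simps insert_iff empty_iff by (elim disjE FalseE) simp_all
  assume "hexagons_adjacent (p, q) (p', q')"
  then obtain e where ne: "(p, q) \<noteq> (p', q')"
      and e: "e \<in> hexagon_sides (p, q)" "e \<in> hexagon_sides (p', q')"
    unfolding hexagons_adjacent_def by blast
  define k l where "k = sum fst e" and "l = sum snd e"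
  define d r where "d = p' - p" and "r = q' - q"
  have "(k - 2 * p, l - 2 * q) \<in> ?M" "(k - 2 * p', l - 2 * q') \<in> ?M"
    using M e by (simp_all add: k_def l_def)
  then obtain m n m' n' where mn: "(m, n) \<in> ?M" "(m', n') \<in> ?M"
      and "2 * d = m - m'" "2 * r = n - n'"
    by (rule that[of "k - 2 * p" "l - 2 * q" "k - 2 * p'" "l - 2 * q'"])
      (simp_all only: d_def r_def algebra_simps)
  then have dr: "d = (m - m') div 2" "r = (n - n') div 2" "even (m - m')"
    by presburger+
  have par: "even (d + r)" "d \<noteq> 0 \<or> r \<noteq> 0"
    using assms ne by (auto simp: d_def r_def)
  have "(d, r) \<in> {(2, 0), (1, 3), (-1, 3), (-2, 0), (-1, -3), (1, -3)}"
    using mn par dr(3) unfolding dr(1,2) insert_iff empty_iff prod.inject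
    by (elim disjE conjE FalseE; simp)
  then show ?R
    by (simp only: d_def r_def)
next
  assume ?R
  then show "hexagons_adjacent (p, q) (p', q')"
    unfolding insert_iff empty_iff prod.inject
    by (elim disjE conjE FalseE) (simp_all add: hexagons_adjacent_def diff_eq_eq doubleton_eq_iff)
qed


section \<open>The pyrene chain\<close>

definition hex_u :: "nat \<Rightarrow> point" where "hex_u i = (4 * int i, 0)"
definition hex_w :: "nat \<Rightarrow> point" where "hex_w i = (4 * int i + 2, 0)"
definition hex_a :: "nat \<Rightarrow> point" where "hex_a i = (4 * int i + 1, 3)"
definition hex_b :: "nat \<Rightarrow> point" where "hex_b i = (4 * int i + 1, -3)"

definition pyrene_chain :: "nat \<Rightarrow> (point, point set) multigraph" where
  "pyrene_chain n = hexagon_graph (\<Union>i\<in>{1..n}. {hex_u i, hex_w i, hex_a i, hex_b i})"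

lemma finite_multigraph_hexagon_graph:
  assumes "finite H"
  shows "finite_multigraph (hexagon_graph H)"
proof -
  have fin: "finite (hexagon_corners c)" "finite (hexagon_sides c)" for c
    by (cases c, simp)+
  have ends: "\<exists>a b. e = {a, b} \<and> a \<in> hexagon_corners c \<and> b \<in> hexagon_corners c"
    if "e \<in> hexagon_sides c" for e c
  proof (cases c)
    case (Pair p q)
    show ?thesis
      using that unfolding Pair hexagon_sides.simps insert_iff empty_iff
      by (elim disjE FalseE) (rule exI, rule exI, rule conjI, assumption, simp)+
  qed
  have "\<exists>a\<in>\<Union>(hexagon_corners ` H). \<exists>b\<in>\<Union>(hexagon_corners ` H). e = {a, b}"
    if e: "e \<in> \<Union>(hexagon_sides ` H)" for e
  proof -
    from e obtain c where c: "c \<in> H" "e \<in> hexagon_sides c" by (rule UN_E)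
    from ends[OF c(2)] obtain a b where
      "e = {a, b}" "a \<in> hexagon_corners c" "b \<in> hexagon_corners c" by (elim exE conjE)
    with c(1) show ?thesis by (intro bexI[of _ a] bexI[of _ b] UN_I[of c])
  qed
  moreover have "finite (\<Union>(hexagon_corners ` H))" "finite (\<Union>(hexagon_sides ` H))"
    by (rule finite_UN_I[OF assms fin(1)], rule finite_UN_I[OF assms fin(2)])
  ultimately show ?thesis
    unfolding finite_multigraph_def hexagon_graph_def multigraph.simps by (intro conjI ballI)
qed

lemma finite_multigraph_pyrene_chain: "finite_multigraph (pyrene_chain n)"
  unfolding pyrene_chain_def by (rule finite_multigraph_hexagon_graph) simp

lemma pyrene_chain_adjacent:
  "hexagons_adjacent (hex_u i) (hex_w j) \<longleftrightarrow> i = j \<or> i = Suc j"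
  "hexagons_adjacent (hex_u i) (hex_a j) \<longleftrightarrow> i = j"
  "hexagons_adjacent (hex_u i) (hex_b j) \<longleftrightarrow> i = j"
  "hexagons_adjacent (hex_w i) (hex_a j) \<longleftrightarrow> i = j"
  "hexagons_adjacent (hex_w i) (hex_b j) \<longleftrightarrow> i = j"
  "\<not> hexagons_adjacent (hex_a i) (hex_b j)"
  "\<not> hexagons_adjacent (hex_u i) (hex_u j)" "\<not> hexagons_adjacent (hex_w i) (hex_w j)"
  "\<not> hexagons_adjacent (hex_a i) (hex_a j)" "\<not> hexagons_adjacent (hex_b i) (hex_b j)"
  by (simp_all add: hex_u_def hex_w_def hex_a_def hex_b_def hexagons_adjacent_iff, presburger+)


section \<open>The algebraic closure of $\mathbb{Q}(x,y)$\<close>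

text \<open>\<open>int poly poly\<close> is $\mathbb{Z}[x][y]$, and the field of fractions of $\mathbb{Z}[x,y]$ is
  $\mathbb{Q}(x,y)$.\<close>

type_synonym Qxy_closure = "int poly poly fract alg_closure"

definition var_x :: Qxy_closure where "var_x = to_ac (to_fract [:[:0, 1:]:])"
definition var_y :: Qxy_closure where "var_y = to_ac (to_fract [:0, 1:])"

end

theory Submission
  imports Defs "HOL-Library.Multiset"
begin

text \<open>Give every edge a pair of weights: \<open>a\<close> if it is deleted and \<open>(y - 1) * b\<close> if it is
  contracted. The \<open>state_sum\<close> adds up the products of these weights over all subsets of
  edges to be contracted, times \<open>((x - 1) * (y - 1))\<close> to the number of components. With all
  weights equal to \<open>(1, 1)\<close> it is the Tutte polynomial up to known powers of \<open>x - 1\<close> and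
  \<open>y - 1\<close> (\<open>tutte_eq_state_sum\<close>). The gain is that a network that meets the rest of the
  graph in two vertices only acts like a single edge between them, of a suitable weight; for
  edges in series and in parallel this weight is given by an explicit formula.

  The chain consists of \<open>n\<close> pyrenes, neighbours sharing an edge. Suppose that everything to
  the left of a pyrene has been absorbed into a weight \<open>(a, b)\<close> of its leftmost edge. Then
  series and parallel reductions, together with deletion and contraction of three edges,
  absorb the pyrene into a weight of its rightmost edge (\<open>block_reduction\<close>), and the new
  weight depends linearly on the old one (\<open>block_weight_eq\<close>). Write \<open>p\<close>, \<open>q\<close>, \<open>r\<close>, \<open>t\<close> for
  \<open>del_del\<close>, \<open>con_del\<close>, \<open>del_con\<close>, \<open>con_con\<close>. The linear map has the rows \<open>(p, q)\<close> and
  \<open>(p + y * r, q + y * t)\<close>. The Tutte polynomial of the chain is \<open>(x - 1) * a + b\<close>, where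
  \<open>(a, b)\<close> is the image of \<open>(1, 1)\<close> under the \<open>n\<close>-th power of this map
  (\<open>tutte_pyrene_chain\<close>).

  The polynomials \<open>I\<close>, \<open>J\<close>, \<open>K\<close> are the Tutte polynomials of a pyrene whose leftmost and
  rightmost edges are both contracted, one contracted and one deleted, or both deleted. In
  terms of the map they are \<open>I = q + (y - 1) * t\<close>, \<open>J = p + (y - 1) * r = (x - 1) * q + t\<close>
  and \<open>K = (x - 1) * p + r\<close>. Solving for the entries brings in, up to sign, the determinant
  \<open>(x - 1) * (y - 1) - 1 = x * y - x - y\<close> and yields \<open>A = y * t\<close>, \<open>B = q\<close>, \<open>C = y * (r + t)\<close>
  and \<open>D = p + q\<close>. Hence \<open>A + D\<close> is the trace of the map, \<open>A * D - B * C\<close> is its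
  determinant, and by Cayley-Hamilton the Tutte polynomials of the chains satisfy a linear
  recurrence of order two with these coefficients. Both formulas solve this recurrence: one
  is Binet's formula, the other the expansion of a Lucas sequence into binomial
  coefficients. Binet's formula needs two different roots, that is a nonzero discriminant,
  and the discriminant does not vanish at \<open>x = y = 0\<close>.\<close>

section \<open>Components and contraction\<close>

definition linked :: "'v set \<Rightarrow> 'v set set \<Rightarrow> ('v \<times> 'v) set" where
  "linked V F = {(u, w). u \<in> V \<and> w \<in> V \<and> (u, w) \<in> {(a, b). {a, b} \<in> F}\<^sup>*}"

definition ncomp :: "'v set \<Rightarrow> 'v set set \<Rightarrow> nat" where
  "ncomp V F = card (V // linked V F)"

definition edge_on :: "'v set \<Rightarrow> 'v set \<Rightarrow> bool" where
  "edge_on V e \<longleftrightarrow> (\<exists>a\<in>V. \<exists>b\<in>V. e = {a, b})"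

lemma edge_on_doubleton [simp]: "edge_on V {a, b} \<longleftrightarrow> a \<in> V \<and> b \<in> V"
  by (auto simp: edge_on_def doubleton_eq_iff)

lemma edge_on_mono: "edge_on V e \<Longrightarrow> V \<subseteq> W \<Longrightarrow> edge_on W e"
  by (auto simp: edge_on_def)

lemma equiv_linked: "equiv V (linked V F)"
proof (rule equivI)
  have s: "sym ({(a, b). {a, b} \<in> F}\<^sup>*)"
    by (rule sym_rtrancl) (auto simp: sym_def insert_commute)
  show "linked V F \<subseteq> V \<times> V" "refl_on V (linked V F)"
    by (auto simp: linked_def refl_on_def)
  show "sym (linked V F)"
    using s by (auto simp: linked_def sym_def)
  show "trans (linked V F)"
    by (auto simp: linked_def trans_def)
qed

lemma rtrancl_edges_sym:
  "(u, w) \<in> {(a, b). {a, b} \<in> F}\<^sup>* \<Longrightarrow> (w, u) \<in> {(a, b). {a, b} \<in> F}\<^sup>*"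
  by (rule symD[OF sym_rtrancl]) (auto simp: sym_def insert_commute)

text \<open>A surjection identifies the classes of an equivalence relation with the classes of its
  pullback. It is used for the surjection that merges two vertices.\<close>

lemma card_quotient_pullback:
  assumes "equiv V R" and surj: "\<pi> ` V' = V"
    and R': "R' = {(u, w). u \<in> V' \<and> w \<in> V' \<and> (\<pi> u, \<pi> w) \<in> R}"
  shows "card (V' // R') = card (V // R)"
proof -
  define f where "f D = {u \<in> V'. \<pi> u \<in> D}" for D
  have "R' `` {u} = f (R `` {\<pi> u})" if "u \<in> V'" for u
    using that by (auto simp: R' f_def)
  then have "V' // R' = f ` (V // R)"
    using surj by (auto simp: quotient_def)
  moreover have "inj_on f (V // R)"
  proof (rule inj_on_inverseI)
    fix D assume "D \<in> V // R"
    then have "D \<subseteq> \<pi> ` V'"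
      using assms(1) surj by (simp add: in_quotient_imp_subset)
    then show "\<pi> ` f D = D"
      by (auto simp: f_def)
  qed
  ultimately show ?thesis
    by (simp add: card_image)
qed

definition identify :: "'v \<Rightarrow> 'v \<Rightarrow> 'v \<Rightarrow> 'v" where
  "identify c s u = (if u = c then s else u)"

text \<open>Contracting an edge does not change the number of components: when \<open>c\<close> is already joined to
  \<open>s\<close>, two vertices are joined if and only if their images under the merging map are.\<close>

lemma ncomp_contract:
  assumes c: "c \<notin> V" and s: "s \<in> V" and F: "\<forall>e\<in>F. edge_on (insert c V) e"
  shows "ncomp (insert c V) (insert {s, c} F) = ncomp V (image (identify c s) ` F)"
proof -
  define \<pi> where "\<pi> = identify c s"
  have \<pi>: "\<pi> c = s" "\<pi> s = s" "\<And>u. u \<noteq> c \<Longrightarrow> \<pi> u = u"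
    by (auto simp: \<pi>_def identify_def)
  let ?S = "{(a, b). {a, b} \<in> insert {s, c} F}" and ?T = "{(a, b). {a, b} \<in> image \<pi> ` F}"
  have push: "(\<pi> u, \<pi> w) \<in> ?T\<^sup>*" if "(u, w) \<in> ?S\<^sup>*" for u w
    using that
  proof induction
    case (step w z)
    then have "{w, z} = {s, c} \<or> {w, z} \<in> F" by auto
    then show ?case
    proof
      assume "{w, z} = {s, c}"
      then have "\<pi> w = \<pi> z" by (auto simp: doubleton_eq_iff \<pi>)
      with step.IH show ?thesis by simp
    next
      assume "{w, z} \<in> F"
      then have "\<pi> ` {w, z} \<in> image \<pi> ` F" by (rule imageI)
      then have "(\<pi> w, \<pi> z) \<in> ?T" by simp
      with step.IH show ?thesis by (rule rtrancl_into_rtrancl)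
    qed
  qed simp
  have self: "(u, \<pi> u) \<in> ?S\<^sup>*" "(\<pi> u, u) \<in> ?S\<^sup>*" for u
    by (cases "u = c"; auto simp: insert_commute \<pi>)+
  have lift1: "(y, z) \<in> ?S\<^sup>*" if "(y, z) \<in> ?T" for y z
  proof -
    from that obtain e where e: "e \<in> F" "{y, z} = \<pi> ` e" by auto
    with F obtain a b where ab: "e = {a, b}" by (auto simp: edge_on_def)
    have edge: "(a, b) \<in> ?S\<^sup>*" "(b, a) \<in> ?S\<^sup>*"
      using e(1) by (auto simp: ab insert_commute)
    have "{y, z} = {\<pi> a, \<pi> b}" using e(2) by (simp add: ab)
    then have "y = \<pi> a \<and> z = \<pi> b \<or> y = \<pi> b \<and> z = \<pi> a"
      by (simp add: doubleton_eq_iff)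
    then show ?thesis
      using rtrancl_trans[OF self(2) rtrancl_trans[OF edge(1) self(1)]]
        rtrancl_trans[OF self(2) rtrancl_trans[OF edge(2) self(1)]] by auto
  qed
  have lift: "(y, z) \<in> ?S\<^sup>*" if "(y, z) \<in> ?T\<^sup>*" for y z
    using that
  proof induction
    case (step w z)
    show ?case by (rule rtrancl_trans[OF step.IH lift1[OF step.hyps(2)]])
  qed simp
  have iff: "(u, w) \<in> ?S\<^sup>* \<longleftrightarrow> (\<pi> u, \<pi> w) \<in> ?T\<^sup>*" for u w
    using push[of u w] rtrancl_trans[OF self(1) rtrancl_trans[OF lift self(2)]] by blast
  have inV: "\<pi> u \<in> V" if "u \<in> insert c V" for u
    using that s by (cases "u = c") (auto simp: \<pi>)
  show ?thesis
    unfolding ncomp_def \<pi>_def[symmetric]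
  proof (rule card_quotient_pullback[OF equiv_linked, where \<pi> = \<pi>])
    show "\<pi> ` insert c V = V" using c s \<pi> by force
    show "linked (insert c V) (insert {s, c} F) = {(u, w). u \<in> insert c V \<and> w \<in> insert c V \<and>
        (\<pi> u, \<pi> w) \<in> linked V (image \<pi> ` F)}"
      unfolding linked_def using iff inV by blast
  qed
qed

lemma ncomp_isolated:
  assumes "finite V" and c: "c \<notin> V" and F: "\<forall>e\<in>F. edge_on V e"
  shows "ncomp (insert c V) F = Suc (ncomp V F)"
proof -
  have stay: "u = w \<or> u \<in> V \<and> w \<in> V" if "(u, w) \<in> {(a, b). {a, b} \<in> F}\<^sup>*" for u w
    using that
  proof induction
    case (step w z)
    then have "edge_on V {w, z}" using F by blast
    with step.IH show ?case by auto
  qed simp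
  let ?R = "linked V F" and ?R' = "linked (insert c V) F"
  have c': "?R' `` {c} = {c}" using stay c by (auto simp: linked_def)
  have "?R' `` {u} = ?R `` {u}" if "u \<in> V" for u
    using stay c that by (auto simp: linked_def)
  then have "insert c V // ?R' = insert {c} (V // ?R)"
    using c' by (auto simp: quotient_def)
  moreover have "{c} \<notin> V // ?R"
    using c in_quotient_imp_subset[OF equiv_linked] by fastforce
  moreover have "finite (V // ?R)"
    by (rule finite_quotient[OF \<open>finite V\<close>]) (auto simp: linked_def)
  ultimately show ?thesis by (simp add: ncomp_def)
qed

lemma linked_mono: "F \<subseteq> F' \<Longrightarrow> linked V F \<subseteq> linked V F'"
  using rtrancl_mono[of "{(a, b). {a, b} \<in> F}" "{(a, b). {a, b} \<in> F'}"]
  by (auto simp: linked_def)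

lemma finite_quotient_linked: "finite V \<Longrightarrow> finite (V // linked V F)"
  by (rule finite_quotient) (auto simp: linked_def)

lemma ncomp_antimono: "finite V \<Longrightarrow> F \<subseteq> F' \<Longrightarrow> ncomp V F' \<le> ncomp V F"
  using card_image_le[OF finite_quotient_linked, of V "\<lambda>C. linked V F' `` C" F]
    refines_equiv_image_eq[OF linked_mono equiv_linked equiv_linked, of F F' V]
  by (simp add: ncomp_def)

lemma ncomp_empty: "ncomp V {} = card V"
proof -
  have "linked V {} = Id_on V" by (auto simp: linked_def)
  then have "V // linked V {} = (\<lambda>u. {u}) ` V" by (auto simp: quotient_def)
  then show ?thesis by (simp add: ncomp_def card_image)
qed

text \<open>A new edge can at most merge the classes of its two ends \<open>s\<close> and \<open>t\<close>, so the classes other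
  than that of \<open>t\<close> stay distinct.\<close>

lemma ncomp_insert_le:
  assumes V: "finite V" and e: "edge_on V e"
  shows "ncomp V F \<le> Suc (ncomp V (insert e F))"
proof -
  obtain s t where st: "e = {s, t}" "s \<in> V" "t \<in> V" using e by (auto simp: edge_on_def)
  let ?S = "{(a, b). {a, b} \<in> F}" and ?S' = "{(a, b). {a, b} \<in> insert e F}"
  let ?R = "linked V F" and ?R' = "linked V (insert e F)"
  have eqv: "equiv V ?R" "equiv V ?R'" by (rule equiv_linked)+
  have split: "(u, w) \<in> ?S\<^sup>* \<or> ((u, s) \<in> ?S\<^sup>* \<or> (u, t) \<in> ?S\<^sup>*) \<and> ((s, w) \<in> ?S\<^sup>* \<or> (t, w) \<in> ?S\<^sup>*)"
    if "(u, w) \<in> ?S'\<^sup>*" for u w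
    using that
  proof induction
    case (step w z)
    then have "{w, z} = {s, t} \<or> (w, z) \<in> ?S" by (auto simp: st)
    then show ?case
    proof
      assume "{w, z} = {s, t}"
      then have "w = s \<and> z = t \<or> w = t \<and> z = s" by (simp add: doubleton_eq_iff)
      with step.IH show ?thesis by blast
    next
      assume "(w, z) \<in> ?S"
      with step.IH show ?thesis by (meson rtrancl_into_rtrancl)
    qed
  qed simp
  have coarse: "(u, w) \<in> ?R" if "(u, w) \<in> ?R'" "(t, u) \<notin> ?R" "(t, w) \<notin> ?R" for u w
  proof -
    have "u \<in> V" "w \<in> V" using that(1) by (auto simp: linked_def)
    then have "(u, t) \<notin> ?S\<^sup>*" "(t, w) \<notin> ?S\<^sup>*"
      using that(2,3) st rtrancl_edges_sym[of u t F] by (auto simp: linked_def)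
    moreover have "(u, w) \<in> ?S'\<^sup>*" using that(1) by (simp add: linked_def)
    ultimately have "(u, w) \<in> ?S\<^sup>*"
      using split[of u w] by (meson rtrancl_trans)
    with \<open>u \<in> V\<close> \<open>w \<in> V\<close> show ?thesis by (simp add: linked_def)
  qed
  let ?Q = "V // ?R - {?R `` {t}}"
  have "inj_on (\<lambda>C. ?R' `` C) ?Q"
  proof (rule inj_onI)
    fix C D assume C: "C \<in> ?Q" and D: "D \<in> ?Q" and eq: "?R' `` C = ?R' `` D"
    from C obtain u where u: "u \<in> V" "C = ?R `` {u}" by (blast elim: quotientE)
    from D obtain w where w: "w \<in> V" "D = ?R `` {w}" by (blast elim: quotientE)
    have t: "(t, u) \<notin> ?R" "(t, w) \<notin> ?R"
      using C D u(2) w(2) equiv_class_eq[OF eqv(1), of t u] equiv_class_eq[OF eqv(1), of t w]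
      by auto
    have "?R' `` C = ?R' `` {u}" "?R' `` D = ?R' `` {w}"
      unfolding u w by (rule refines_equiv_class_eq2[OF linked_mono eqv], blast)+
    with eq have "(u, w) \<in> ?R'"
      using eq_equiv_class[OF _ eqv(2) w(1)] by simp
    then have "(u, w) \<in> ?R" using coarse t by blast
    then show "C = D" unfolding u w by (rule equiv_class_eq[OF eqv(1)])
  qed
  moreover have "(\<lambda>C. ?R' `` C) ` ?Q \<subseteq> V // ?R'"
  proof -
    have "(\<lambda>C. ?R' `` C) ` (V // ?R) = V // ?R'"
      by (rule refines_equiv_image_eq[OF linked_mono eqv]) (rule subset_insertI)
    then show ?thesis by (metis Diff_subset image_mono)
  qed
  ultimately have "card ?Q \<le> card (V // ?R')"
    by (rule card_inj_on_le[OF _ _ finite_quotient_linked[OF V]])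
  moreover have "card (V // ?R) = Suc (card ?Q)"
    by (rule card.remove[OF finite_quotient_linked[OF V] quotientI[OF st(3)]])
  ultimately show ?thesis
    unfolding ncomp_def by simp
qed

text \<open>The rank of an edge set is at most its size. With the monotonicity of \<open>ncomp\<close> this is what
  makes the subtractions of natural numbers in the Tutte polynomial exact.\<close>

lemma card_le_ncomp_add_card:
  assumes "finite V" "finite S" "\<forall>e\<in>S. edge_on V e"
  shows "card V \<le> ncomp V S + card S"
  using assms(2,3)
proof (induction S)
  case empty
  then show ?case by (simp add: ncomp_empty)
next
  case (insert e S)
  then show ?case using ncomp_insert_le[OF assms(1), of e S] by simp
qed

section \<open>State sums of weighted graphs\<close>

type_synonym ('v, 'a) weighted_edge = "'v set \<times> 'a \<times> 'a"

definition edges_on :: "'v set \<Rightarrow> ('v, 'a) weighted_edge list \<Rightarrow> bool" where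
  "edges_on V es \<longleftrightarrow> (\<forall>w\<in>set es. edge_on V (fst w))"

lemma edges_on_simps [simp]:
  "edges_on V []"
  "edges_on V (w # es) \<longleftrightarrow> edge_on V (fst w) \<and> edges_on V es"
  by (auto simp: edges_on_def)

lemma edges_on_insert: "edges_on V es \<Longrightarrow> edges_on (insert c V) es"
  by (auto simp: edges_on_def intro: edge_on_mono)

context
  fixes x y :: "'a :: comm_ring_1"
begin

abbreviation plain :: "'a \<times> 'a" where
  "plain \<equiv> (1, 1)"

text \<open>The weight that replaces a path \<open>s c t\<close>. The path joins \<open>s\<close> and \<open>t\<close> only if both edges are
  contracted; if both are deleted, \<open>c\<close> becomes a component of its own. A common factor
  \<open>y - 1\<close> is left out and appears in \<open>state_sum_series\<close>; with this normalisation a path of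
  edges of weight \<open>(1, 1)\<close> again has contracted weight \<open>1\<close>.\<close>

definition series :: "'a \<times> 'a \<Rightarrow> 'a \<times> 'a \<Rightarrow> 'a \<times> 'a" where
  "series w w' = ((x - 1) * fst w * fst w' + fst w * snd w' + snd w * fst w', snd w * snd w')"

text \<open>Two parallel edges join their ends unless both are deleted.\<close>

definition parallel :: "'a \<times> 'a \<Rightarrow> 'a \<times> 'a \<Rightarrow> 'a \<times> 'a" where
  "parallel w w' = (fst w * fst w', fst w * snd w' + snd w * fst w' + (y - 1) * snd w * snd w')"

text \<open>Every edge is either deleted or contracted; \<open>F\<close> collects the contracted ones. An edge with
  weight \<open>(a, b)\<close> contributes \<open>a\<close> in the first case and \<open>(y - 1) * b\<close> in the second, and
  each component contributes \<open>(x - 1) * (y - 1)\<close>. Arbitrary weights allow one edge to stand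
  for a whole network that is attached to the rest of the graph at two vertices only.\<close>

primrec state_sum :: "'v set \<Rightarrow> 'v set set \<Rightarrow> ('v, 'a) weighted_edge list \<Rightarrow> 'a" where
  "state_sum V F [] = ((x - 1) * (y - 1)) ^ ncomp V F"
| "state_sum V F (w # es) = fst (snd w) * state_sum V F es
     + (y - 1) * snd (snd w) * state_sum V (insert (fst w) F) es"

lemma state_sum_move: "state_sum V F (es @ w # es') = state_sum V F (w # es @ es')"
proof (induction es arbitrary: F)
  case (Cons w' es)
  show ?case
    by (simp add: Cons insert_commute[of "fst w" "fst w'"] algebra_simps)
qed simp

lemma state_sum_perm: "mset es = mset es' \<Longrightarrow> state_sum V F es = state_sum V F es'"
proof (induction es arbitrary: es' F)
  case (Cons w es)
  then have "w \<in> set es'" by (metis list.set_intros(1) set_mset_mset)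
  then obtain as bs where es': "es' = as @ w # bs" by (meson split_list)
  with Cons.prems have "mset es = mset (as @ bs)" by simp
  from Cons.IH[OF this] show ?case
    unfolding es' state_sum_move by simp
qed simp

lemma state_sum_isolated:
  assumes "finite V" "c \<notin> V" "\<forall>e\<in>F. edge_on V e" "edges_on V es"
  shows "state_sum (insert c V) F es = (x - 1) * (y - 1) * state_sum V F es"
  using assms(3,4)
proof (induction es arbitrary: F)
  case Nil
  then show ?case using assms by (simp add: ncomp_isolated)
next
  case (Cons w es)
  then show ?case by (simp add: distrib_left mult.left_commute)
qed

definition identify_in :: "'v \<Rightarrow> 'v \<Rightarrow> ('v, 'a) weighted_edge list \<Rightarrow> ('v, 'a) weighted_edge list" where
  "identify_in c s = map (\<lambda>w. (identify c s ` fst w, snd w))"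

lemma identify_in_Cons:
  "identify_in c s (w # es) = (identify c s ` fst w, snd w) # identify_in c s es"
  by (simp add: identify_in_def)

lemma identify_in_id:
  assumes "c \<notin> V" "edges_on V es"
  shows "identify_in c s es = es"
proof -
  have "identify c s ` fst w = fst w" if "w \<in> set es" for w
    using assms that by (force simp: edges_on_def edge_on_def identify_def)
  then show ?thesis
    by (simp add: identify_in_def map_idI)
qed

lemma state_sum_identify:
  assumes "c \<notin> V" "s \<in> V" "\<forall>e\<in>F. edge_on (insert c V) e"
    "edges_on (insert c V) es"
  shows "state_sum (insert c V) (insert {s, c} F) es
    = state_sum V (image (identify c s) ` F) (identify_in c s es)"
  using assms(3,4)
proof (induction es arbitrary: F)
  case Nil
  then show ?case using assms by (simp add: ncomp_contract identify_in_def)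
next
  case (Cons w es)
  then show ?case
    by (simp add: insert_commute[of "fst w" "{s, c}"] identify_in_def)
qed

lemma state_sum_delete_contract:
  assumes "mset es = mset (({s, c}, w) # es')" "c \<notin> V" "s \<in> V"
    "edges_on (insert c V) es'"
  shows "state_sum (insert c V) {} es = fst w * state_sum (insert c V) {} es'
    + (y - 1) * snd w * state_sum V {} (identify_in c s es')"
  using state_sum_identify[of c V s "{}" es'] assms
  unfolding state_sum_perm[OF assms(1)] by simp

lemma state_sum_parallel:
  assumes "mset es = mset ((e, w) # (e, w') # es')"
  shows "state_sum V F es = state_sum V F ((e, parallel w w') # es')"
  unfolding state_sum_perm[OF assms] by (simp add: parallel_def algebra_simps)

lemma state_sum_series:
  assumes es: "mset es = mset (({s, c}, w) # ({c, t}, w') # es')"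
    and V: "finite V" "c \<notin> V" "s \<in> V" "t \<in> V" and es': "edges_on V es'"
  shows "state_sum (insert c V) {} es
    = (y - 1) * state_sum V {} (({s, t}, series w w') # es')"
proof -
  have es'_c: "edges_on (insert c V) es'"
    by (rule edges_on_insert[OF es'])
  have st: "identify c s s = s" "identify c s c = s" "identify c s t = t" "identify c t c = t"
    using V by (auto simp: identify_def)
  note id = identify_in_id[OF V(2) es']
  have "state_sum (insert c V) {} es' = (x - 1) * (y - 1) * state_sum V {} es'"
    by (rule state_sum_isolated) (use V es' in auto)
  moreover have "state_sum (insert c V) {{s, c}} es' = state_sum V {} es'"
    using state_sum_identify[of c V s "{}" es'] V es'_c by (simp add: id)
  moreover have "state_sum (insert c V) {{c, t}} es' = state_sum V {} es'"
    using state_sum_identify[of c V t "{}" es'] V es'_c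
    by (simp add: id insert_commute[of c t "{}"])
  moreover have "state_sum (insert c V) {{c, t}, {s, c}} es' = state_sum V {{s, t}} es'"
    using state_sum_identify[of c V s "{{c, t}}" es'] V es'_c st
    by (simp add: id insert_commute[of "{c, t}" "{s, c}" "{}"])
  moreover have "a * (a' * (u * v * Z) + v * b' * Z) + v * b * (a' * Z + v * b' * W)
      = v * ((u * a * a' + a * b' + b * a') * Z + v * (b * b') * W)" for a b a' b' u v Z W :: 'a
    by (simp add: algebra_simps)
  ultimately show ?thesis
    unfolding state_sum_perm[OF es] state_sum.simps series_def fst_conv snd_conv by simp
qed

text \<open>The recursion over the edge list enumerates the subsets of contracted edges, so the state
  sum with all weights \<open>plain\<close> is the subset expansion that underlies the Tutte polynomial.\<close>

lemma state_sum_unweighted: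
  assumes "distinct es"
  shows "state_sum V F (map (\<lambda>e. (e, plain)) es)
    = (\<Sum>S\<in>Pow (set es). ((x - 1) * (y - 1)) ^ ncomp V (S \<union> F) * (y - 1) ^ card S)"
  using assms
proof (induction es arbitrary: F)
  case (Cons e es)
  have d: "distinct es" using Cons.prems by simp
  let ?f = "\<lambda>F S. ((x - 1) * (y - 1)) ^ ncomp V (S \<union> F) * (y - 1) ^ card S"
  have inj: "inj_on (insert e) (Pow (set es))"
    using Cons.prems by (auto simp: inj_on_def)
  have "(\<Sum>S\<in>Pow (set (e # es)). ?f F S)
      = (\<Sum>S\<in>Pow (set es). ?f F S) + (\<Sum>S\<in>insert e ` Pow (set es). ?f F S)"
    using Cons.prems unfolding list.set Pow_insert
    by (intro sum.union_disjoint) auto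
  also have "(\<Sum>S\<in>insert e ` Pow (set es). ?f F S)
      = (\<Sum>S\<in>Pow (set es). (y - 1) * ?f (insert e F) S)"
    unfolding sum.reindex[OF inj] comp_def
  proof (rule sum.cong[OF refl])
    fix S assume "S \<in> Pow (set es)"
    then have "finite S" "e \<notin> S"
      using Cons.prems by (auto intro: finite_subset)
    then show "?f F (insert e S) = (y - 1) * ?f (insert e F) S"
      by (simp add: mult_ac)
  qed
  finally show ?case
    unfolding list.map state_sum.simps Cons.IH[OF d] by (simp add: sum_distrib_left)
qed simp

text \<open>Multiplying the Tutte polynomial by these powers clears the ranks from its exponents: what
  remains of the exponents is the number of components and the number of edges.\<close>

lemma tutte_eq_state_sum:
  fixes V :: "'v set"
  assumes V: "finite V" and es: "distinct es" "\<forall>e\<in>set es. edge_on V e"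
  shows "(x - 1) ^ ncomp V (set es) * (y - 1) ^ card V
      * tutte \<lparr>verts = V, edges = set es, ends = (\<lambda>e. e)\<rparr> x y
    = state_sum V {} (map (\<lambda>e. (e, plain)) es)"
proof -
  let ?G = "\<lparr>verts = V, edges = set es, ends = (\<lambda>e. e)\<rparr> :: ('v, 'v set) multigraph"
  let ?E = "set es"
  have comps: "num_components ?G S = ncomp V S" for S
    by (simp add: num_components_def joined_def ncomp_def linked_def)
  have summand: "(x - 1) ^ ncomp V ?E * (y - 1) ^ card V
      * ((x - 1) ^ (edge_rank ?G ?E - edge_rank ?G S) * (y - 1) ^ (card S - edge_rank ?G S))
    = ((x - 1) * (y - 1)) ^ ncomp V S * (y - 1) ^ card S" if S: "S \<in> Pow ?E" for S
  proof -
    have le: "ncomp V ?E \<le> ncomp V S" "ncomp V S \<le> card V" "card V \<le> ncomp V S + card S"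
      using S es V ncomp_antimono[OF V, of S ?E] ncomp_antimono[OF V, of "{}" S]
        card_le_ncomp_add_card[OF V, of S] finite_subset[of S ?E]
      by (auto simp: ncomp_empty)
    have "ncomp V ?E + (edge_rank ?G ?E - edge_rank ?G S) = ncomp V S"
      "card V + (card S - edge_rank ?G S) = ncomp V S + card S"
      using le by (simp_all add: edge_rank_def comps)
    then have "(x - 1) ^ ncomp V ?E * (x - 1) ^ (edge_rank ?G ?E - edge_rank ?G S)
          = (x - 1) ^ ncomp V S"
      "(y - 1) ^ card V * (y - 1) ^ (card S - edge_rank ?G S)
          = (y - 1) ^ ncomp V S * (y - 1) ^ card S"
      by (simp_all only: flip: power_add)
    note exponents = this
    have swap: "a * b * (c * d) = (a * c) * (b * d)" for a b c d :: 'a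
      by (simp only: mult_ac)
    show ?thesis
      by (subst swap) (simp only: exponents power_mult_distrib mult.assoc)
  qed
  show ?thesis
    unfolding state_sum_unweighted[OF es(1)] tutte_def sum_distrib_left multigraph.simps
      Un_empty_right
    by (rule sum.cong[OF refl summand])
qed

section \<open>Reduction of a pyrene to one edge\<close>

text \<open>The weight between \<open>r\<close> and \<open>r'\<close> of the path \<open>r q q' r'\<close> whose middle edge has weight \<open>d\<close>,
  together with the edge \<open>r r'\<close>.\<close>

definition attach_exits :: "'a \<times> 'a \<Rightarrow> 'a \<times> 'a" where
  "attach_exits d = parallel (series (series d plain) plain) plain"

text \<open>The four weights that \<open>attach_exits\<close> is applied to belong to the four networks into which
  the core falls apart, see the proof of \<open>core_reduction\<close>; the factor \<open>y + 1\<close> is the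
  contracted weight of two parallel edges of weight \<open>plain\<close>.\<close>

definition core_weight :: "'a \<times> 'a \<Rightarrow> 'a \<times> 'a \<Rightarrow> 'a \<times> 'a" where
  "core_weight h w =
    (let g = parallel (series plain plain) h;
         k = parallel (series h plain) plain;
         j = parallel h plain;
         e1 = attach_exits (series g (series w g));
         e2 = attach_exits (series k k);
         e3 = attach_exits (parallel (series h h) (series plain plain));
         e4 = attach_exits (series j j)
     in (fst e1 + fst w * fst e2 + snd w * (fst e3 + (y + 1) * fst e4),
         snd e1 + fst w * snd e2 + snd w * (snd e3 + (y + 1) * snd e4)))"

text \<open>The core of a block consists of two triangles \<open>p m q\<close> and \<open>p' m' q'\<close> joined by \<open>m m'\<close> and,
  on the left, by an edge \<open>p p'\<close> that stands for everything to the left; \<open>h\<close> is the weight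
  of the outer path from \<open>p\<close> to \<open>q\<close>. This network is not series-parallel. It becomes so when
  \<open>m m'\<close> is deleted, or when \<open>m m'\<close> is contracted and \<open>p p'\<close> deleted; when both are
  contracted, the edges \<open>p m\<close> and \<open>p' m'\<close> become parallel, and deleting or contracting the
  edge that replaces them suffices. Each of the six vertices that disappear contributes one
  factor \<open>y - 1\<close>, through a series reduction or a contraction.\<close>

lemma core_reduction:
  fixes V :: "'v set"
  assumes V: "finite V" "r \<in> V" "r' \<in> V"
    and new: "distinct [m', p', m, p, q, q']"
      "m' \<notin> V" "p' \<notin> V" "m \<notin> V" "p \<notin> V" "q \<notin> V" "q' \<notin> V"
    and es: "edges_on V es"
  shows "state_sum (insert m' (insert p' (insert m (insert p (insert q (insert q' V)))))) {}
      (({m, m'}, plain) # ({p, p'}, w) # ({p', q'}, h) # ({p', m'}, plain) # ({m', q'}, plain) #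
            ({p, q}, h) # ({p, m}, plain) # ({m, q}, plain) # ({q, r}, plain) #
            ({q', r'}, plain) # ({r, r'}, plain) # es)
    = (y - 1) ^ 6 * state_sum V {} (({r, r'}, core_weight h w) # es)"
proof -
  let ?Z = "state_sum"
  let ?Q = "insert q (insert q' V)"
  let ?exits = "({q, r}, plain) # ({q', r'}, plain) # ({r, r'}, plain) # es"
  let ?arch = "({p, q}, h) # ({p, m}, plain) # ({m, q}, plain) # ?exits"
  let ?g = "parallel (series plain plain) h" and ?k = "parallel (series h plain) plain"
    and ?j = "parallel h plain"
  let ?T = "\<lambda>d. ?Z V {} (({r, r'}, attach_exits d) # es)"
  have ne: "r \<noteq> m'" "r \<noteq> p'" "r \<noteq> m" "r \<noteq> p" "r' \<noteq> m'" "r' \<noteq> p'" "r' \<noteq> m" "r' \<noteq> p"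
    using V new by auto
  \<comment> \<open>The reversed list supplies each inequality in the other orientation.\<close>
  note distinct = new(1)[simplified] distinct_rev[THEN iffD2, OF new(1), simplified]
  have es_fixed: "identify_in c s es = es" if "c \<notin> V" for c s
    by (rule identify_in_id[OF that es])
  note rules = V new(2-) distinct es edges_on_insert insert_commute add_mset_commute
  have finish: "?Z ?Q {} (({q, q'}, d) # ?exits) = (y - 1) ^ 2 * ?T d" for d
  proof -
    have 1: "?Z ?Q {} (({q, q'}, d) # ?exits)
      = (y - 1) * ?Z (insert q' V) {}
          (({q', r}, series d plain) # ({q', r'}, plain) # ({r, r'}, plain) # es)"
      by (rule state_sum_series) (simp_all add: rules)
    have 2: "?Z (insert q' V) {}
          (({q', r}, series d plain) # ({q', r'}, plain) # ({r, r'}, plain) # es)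
      = (y - 1) * ?Z V {} (({r, r'}, series (series d plain) plain) # ({r, r'}, plain) # es)"
      by (rule state_sum_series) (simp_all add: rules)
    have 3: "?Z V {} (({r, r'}, series (series d plain) plain) # ({r, r'}, plain) # es) = ?T d"
      unfolding attach_exits_def by (rule state_sum_parallel) (simp add: rules)
    show ?thesis by (simp only: 1 2 3) (simp add: power2_eq_square mult.assoc)
  qed
  have mm'_deleted: "?Z (insert m' (insert p' (insert m (insert p ?Q)))) {}
        (({p, p'}, w) # ({p', q'}, h) # ({p', m'}, plain) # ({m', q'}, plain) # ?arch)
      = (y - 1) ^ 6 * ?T (series ?g (series w ?g))"
  proof -
    have 1: "?Z (insert m' (insert p' (insert m (insert p ?Q)))) {}
          (({p, p'}, w) # ({p', q'}, h) # ({p', m'}, plain) # ({m', q'}, plain) # ?arch)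
      = (y - 1) * ?Z (insert p' (insert m (insert p ?Q))) {}
            (({p', q'}, series plain plain) # ({p, p'}, w) # ({p', q'}, h) # ?arch)"
      by (rule state_sum_series) (simp_all add: rules)
    have 2: "?Z (insert p' (insert m (insert p ?Q))) {}
          (({p', q'}, series plain plain) # ({p, p'}, w) # ({p', q'}, h) # ?arch)
      = ?Z (insert p' (insert m (insert p ?Q))) {} (({p', q'}, ?g) # ({p, p'}, w) # ?arch)"
      by (rule state_sum_parallel) (simp_all add: rules)
    have 3: "?Z (insert p' (insert m (insert p ?Q))) {} (({p', q'}, ?g) # ({p, p'}, w) # ?arch)
      = (y - 1) * ?Z (insert m (insert p ?Q)) {} (({p, q'}, series w ?g) # ?arch)"
      by (rule state_sum_series) (simp_all add: rules)
    have 4: "?Z (insert m (insert p ?Q)) {} (({p, q'}, series w ?g) # ?arch)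
      = (y - 1) * ?Z (insert p ?Q) {} (({p, q}, series plain plain) # ({p, q'}, series w ?g) #
            ({p, q}, h) # ?exits)"
      by (rule state_sum_series) (simp_all add: rules)
    have 5: "?Z (insert p ?Q) {} (({p, q}, series plain plain) # ({p, q'}, series w ?g) #
          ({p, q}, h) # ?exits)
      = ?Z (insert p ?Q) {} (({p, q}, ?g) # ({p, q'}, series w ?g) # ?exits)"
      by (rule state_sum_parallel) (simp_all add: rules)
    have 6: "?Z (insert p ?Q) {} (({p, q}, ?g) # ({p, q'}, series w ?g) # ?exits)
      = (y - 1) * ?Z ?Q {} (({q, q'}, series ?g (series w ?g)) # ?exits)"
      by (rule state_sum_series) (simp_all add: rules)
    show ?thesis
      by (simp only: 1 2 3 4 5 6 finish) (simp add: power_numeral_reduce mult.assoc)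
  qed
  have pp'_deleted: "?Z (insert p' (insert m (insert p ?Q))) {}
        (({p', q'}, h) # ({p', m}, plain) # ({m, q'}, plain) # ?arch)
      = (y - 1) ^ 5 * ?T (series ?k ?k)"
  proof -
    have 1: "?Z (insert p' (insert m (insert p ?Q))) {}
          (({p', q'}, h) # ({p', m}, plain) # ({m, q'}, plain) # ?arch)
      = (y - 1) * ?Z (insert m (insert p ?Q)) {}
            (({q', m}, series h plain) # ({m, q'}, plain) # ?arch)"
      by (rule state_sum_series) (simp_all add: rules)
    have 2: "?Z (insert m (insert p ?Q)) {} (({q', m}, series h plain) # ({m, q'}, plain) # ?arch)
      = ?Z (insert m (insert p ?Q)) {} (({m, q'}, ?k) # ?arch)"
      by (rule state_sum_parallel) (simp_all add: rules)
    have 3: "?Z (insert m (insert p ?Q)) {} (({m, q'}, ?k) # ?arch)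
      = ?Z (insert p (insert m ?Q)) {} (({m, q'}, ?k) # ?arch)"
      by (simp add: insert_commute)
    have 4: "?Z (insert p (insert m ?Q)) {} (({m, q'}, ?k) # ?arch)
      = (y - 1) * ?Z (insert m ?Q) {} (({q, m}, series h plain) # ({m, q}, plain) #
            ({m, q'}, ?k) # ?exits)"
      by (rule state_sum_series) (simp_all add: rules)
    have 5: "?Z (insert m ?Q) {} (({q, m}, series h plain) # ({m, q}, plain) # ({m, q'}, ?k) #
          ?exits)
      = ?Z (insert m ?Q) {} (({q, m}, ?k) # ({m, q'}, ?k) # ?exits)"
      by (rule state_sum_parallel) (simp_all add: rules)
    have 6: "?Z (insert m ?Q) {} (({q, m}, ?k) # ({m, q'}, ?k) # ?exits)
      = (y - 1) * ?Z ?Q {} (({q, q'}, series ?k ?k) # ?exits)"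
      by (rule state_sum_series) (simp_all add: rules)
    show ?thesis
      by (simp only: 1 2 3 4 5 6 finish) (simp add: power_numeral_reduce mult.assoc)
  qed
  have pm_deleted: "?Z (insert m (insert p ?Q)) {}
        (({p, q}, h) # ({m, q}, plain) # ({p, q'}, h) # ({m, q'}, plain) # ?exits)
      = (y - 1) ^ 4 * ?T (parallel (series h h) (series plain plain))"
  proof -
    have 1: "?Z (insert m (insert p ?Q)) {} (({p, q}, h) # ({m, q}, plain) # ({p, q'}, h) #
          ({m, q'}, plain) # ?exits)
      = (y - 1) * ?Z (insert p ?Q) {} (({q, q'}, series plain plain) # ({p, q}, h) #
            ({p, q'}, h) # ?exits)"
      by (rule state_sum_series) (simp_all add: rules)
    have 2: "?Z (insert p ?Q) {} (({q, q'}, series plain plain) # ({p, q}, h) # ({p, q'}, h) #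
          ?exits)
      = (y - 1) * ?Z ?Q {} (({q, q'}, series h h) # ({q, q'}, series plain plain) # ?exits)"
      by (rule state_sum_series) (simp_all add: rules)
    have 3: "?Z ?Q {} (({q, q'}, series h h) # ({q, q'}, series plain plain) # ?exits)
      = ?Z ?Q {} (({q, q'}, parallel (series h h) (series plain plain)) # ?exits)"
      by (rule state_sum_parallel) (simp_all add: rules)
    show ?thesis
      by (simp only: 1 2 3 finish) (simp add: power_numeral_reduce mult.assoc)
  qed
  have pm_contracted: "?Z (insert p ?Q) {} (({p, q}, h) # ({p, q}, plain) # ({p, q'}, h) #
        ({p, q'}, plain) # ?exits)
      = (y - 1) ^ 3 * ?T (series ?j ?j)"
  proof -
    have 1: "?Z (insert p ?Q) {} (({p, q}, h) # ({p, q}, plain) # ({p, q'}, h) #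
          ({p, q'}, plain) # ?exits)
      = ?Z (insert p ?Q) {} (({p, q}, ?j) # ({p, q'}, h) # ({p, q'}, plain) # ?exits)"
      by (rule state_sum_parallel) (simp_all add: rules)
    have 2: "?Z (insert p ?Q) {} (({p, q}, ?j) # ({p, q'}, h) # ({p, q'}, plain) # ?exits)
      = ?Z (insert p ?Q) {} (({p, q'}, ?j) # ({p, q}, ?j) # ?exits)"
      by (rule state_sum_parallel) (simp_all add: rules)
    have 3: "?Z (insert p ?Q) {} (({p, q'}, ?j) # ({p, q}, ?j) # ?exits)
      = (y - 1) * ?Z ?Q {} (({q, q'}, series ?j ?j) # ?exits)"
      by (rule state_sum_series) (simp_all add: rules)
    show ?thesis
      by (simp only: 1 2 3 finish) (simp add: power_numeral_reduce mult.assoc)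
  qed
  have pp'_contracted: "?Z (insert m (insert p ?Q)) {}
        (({p, q'}, h) # ({p, m}, plain) # ({m, q'}, plain) # ?arch)
      = fst (parallel plain plain) * ((y - 1) ^ 4 * ?T (parallel (series h h) (series plain plain)))
        + (y - 1) * snd (parallel plain plain) * ((y - 1) ^ 3 * ?T (series ?j ?j))"
  proof -
    have 1: "?Z (insert m (insert p ?Q)) {} (({p, q'}, h) # ({p, m}, plain) # ({m, q'}, plain) #
          ?arch)
      = ?Z (insert m (insert p ?Q)) {} (({p, m}, parallel plain plain) # ({p, q}, h) #
            ({m, q}, plain) # ({p, q'}, h) # ({m, q'}, plain) # ?exits)"
      by (rule state_sum_parallel) (simp add: rules)
    have 2: "identify_in m p (({p, q}, h) # ({m, q}, plain) # ({p, q'}, h) # ({m, q'}, plain) #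
          ?exits)
      = ({p, q}, h) # ({p, q}, plain) # ({p, q'}, h) # ({p, q'}, plain) # ?exits"
      using distinct ne new(2-) by (simp add: identify_in_Cons identify_def es_fixed insert_commute)
    show ?thesis
      unfolding 1
      by (subst state_sum_delete_contract[OF refl])
        (simp_all only: 2 pm_deleted pm_contracted, simp_all add: rules)
  qed
  have mm'_contracted: "?Z (insert p' (insert m (insert p ?Q))) {}
        (({p, p'}, w) # ({p', q'}, h) # ({p', m}, plain) # ({m, q'}, plain) # ?arch)
      = fst w * ((y - 1) ^ 5 * ?T (series ?k ?k))
        + (y - 1) * snd w * ?Z (insert m (insert p ?Q)) {}
              (({p, q'}, h) # ({p, m}, plain) # ({m, q'}, plain) # ?arch)"
  proof -
    have 1: "identify_in p' p (({p', q'}, h) # ({p', m}, plain) # ({m, q'}, plain) # ?arch)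
      = ({p, q'}, h) # ({p, m}, plain) # ({m, q'}, plain) # ?arch"
      using distinct ne new(2-) by (simp add: identify_in_Cons identify_def es_fixed insert_commute)
    show ?thesis
      by (subst state_sum_delete_contract[OF refl])
        (simp_all only: 1 pp'_deleted, simp_all add: rules)
  qed
  have core: "?Z (insert m' (insert p' (insert m (insert p ?Q)))) {}
        (({m, m'}, plain) # ({p, p'}, w) # ({p', q'}, h) # ({p', m'}, plain) #
        ({m', q'}, plain) # ?arch)
      = (y - 1) ^ 6 * ?T (series ?g (series w ?g))
        + (y - 1) * ?Z (insert p' (insert m (insert p ?Q))) {}
              (({p, p'}, w) # ({p', q'}, h) # ({p', m}, plain) # ({m, q'}, plain) # ?arch)"
  proof -
    have 1: "identify_in m' m (({p, p'}, w) # ({p', q'}, h) # ({p', m'}, plain) #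
          ({m', q'}, plain) # ?arch)
      = ({p, p'}, w) # ({p', q'}, h) # ({p', m}, plain) # ({m, q'}, plain) # ?arch"
      using distinct ne new(2-) by (simp add: identify_in_Cons identify_def es_fixed insert_commute)
    show ?thesis
      by (subst state_sum_delete_contract[OF refl])
        (simp_all only: 1 mm'_deleted, simp_all add: rules)
  qed
  show ?thesis
    unfolding core mm'_contracted pp'_contracted core_weight_def Let_def
    by (simp add: parallel_def[of plain plain] algebra_simps power_numeral_reduce)
qed

definition block_weight :: "'a \<times> 'a \<Rightarrow> 'a \<times> 'a" where
  "block_weight w = core_weight (series (series (series plain plain) plain) plain)
     (series (series plain w) plain)"

text \<open>A block is a pyrene without its leftmost edge \<open>l l'\<close>, which comes with an arbitrary weight
  \<open>w\<close> because it also stands for all earlier blocks. Series reductions remove the paths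
  \<open>p a1 a2 a3 q\<close>, \<open>p' b1 b2 b3 q'\<close> and \<open>p l l' p'\<close>, and leave the core.\<close>

lemma block_reduction:
  fixes V :: "'v set"
  assumes V: "finite V" "r \<in> V" "r' \<in> V"
    and new: "distinct [a1, a2, a3, b1, b2, b3, l, l', m', p', m, p, q, q']"
      "set [a1, a2, a3, b1, b2, b3, l, l', m', p', m, p, q, q'] \<inter> V = {}"
    and es: "edges_on V es"
  shows "state_sum
      (insert a1 (insert a2 (insert a3 (insert b1 (insert b2 (insert b3 (insert l
            (insert l' (insert m' (insert p' (insert m (insert p (insert q
            (insert q' V)))))))))))))) {}
      (({l, l'}, w) # map (\<lambda>e. (e, plain))
        [{l, p}, {l', p'}, {p, a1}, {a1, a2}, {a2, a3}, {a3, q},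
         {p', b1}, {b1, b2}, {b2, b3}, {b3, q'}, {m, m'}, {p', m'},
         {m', q'}, {p, m}, {m, q}, {q, r}, {q', r'}, {r, r'}] @ es)
    = (y - 1) ^ 14 * state_sum V {} (({r, r'}, block_weight w) # es)"
proof -
  let ?Z = "state_sum"
  let ?W = "insert m' (insert p' (insert m (insert p (insert q (insert q' V)))))"
  let ?h = "series (series (series plain plain) plain) plain"
  let ?rest = "({m, m'}, plain) # ({p', m'}, plain) # ({m', q'}, plain) # ({p, m}, plain) #
        ({m, q}, plain) # ({q, r}, plain) # ({q', r'}, plain) # ({r, r'}, plain) # es"
  have notin: "a1 \<notin> V" "a2 \<notin> V" "a3 \<notin> V" "b1 \<notin> V" "b2 \<notin> V" "b3 \<notin> V" "l \<notin> V"
    "l' \<notin> V" "m' \<notin> V" "p' \<notin> V" "m \<notin> V" "p \<notin> V" "q \<notin> V" "q' \<notin> V"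
    using new(2) by auto
  note distinct = new(1)[simplified] distinct_rev[THEN iffD2, OF new(1), simplified]
  note rules = V es notin distinct edges_on_insert insert_commute add_mset_commute
  have 1: "?Z (insert a1 (insert a2 (insert a3 (insert b1 (insert b2 (insert b3 (insert l
        (insert l' ?W)))))))) {} (({l, l'}, w) # ({l, p}, plain) # ({l', p'}, plain) #
        ({p, a1}, plain) # ({a1, a2}, plain) # ({a2, a3}, plain) # ({a3, q}, plain) #
        ({p', b1}, plain) # ({b1, b2}, plain) # ({b2, b3}, plain) # ({b3, q'}, plain) # ?rest)
      = (y - 1) * ?Z (insert a2 (insert a3 (insert b1 (insert b2 (insert b3 (insert l
            (insert l' ?W))))))) {} (({p, a2}, series plain plain) # ({l, l'}, w) #
            ({l, p}, plain) # ({l', p'}, plain) # ({a2, a3}, plain) # ({a3, q}, plain) #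
            ({p', b1}, plain) # ({b1, b2}, plain) # ({b2, b3}, plain) # ({b3, q'}, plain) #
            ?rest)"
    by (rule state_sum_series) (simp_all add: rules)
  have 2: "?Z (insert a2 (insert a3 (insert b1 (insert b2 (insert b3 (insert l
        (insert l' ?W))))))) {} (({p, a2}, series plain plain) # ({l, l'}, w) # ({l, p}, plain) #
        ({l', p'}, plain) # ({a2, a3}, plain) # ({a3, q}, plain) # ({p', b1}, plain) #
        ({b1, b2}, plain) # ({b2, b3}, plain) # ({b3, q'}, plain) # ?rest)
      = (y - 1) * ?Z (insert a3 (insert b1 (insert b2 (insert b3 (insert l
            (insert l' ?W)))))) {} (({p, a3}, series (series plain plain) plain) # ({l, l'}, w) #
            ({l, p}, plain) # ({l', p'}, plain) # ({a3, q}, plain) # ({p', b1}, plain) #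
            ({b1, b2}, plain) # ({b2, b3}, plain) # ({b3, q'}, plain) # ?rest)"
    by (rule state_sum_series) (simp_all add: rules)
  have 3: "?Z (insert a3 (insert b1 (insert b2 (insert b3 (insert l (insert l' ?W)))))) {}
        (({p, a3}, series (series plain plain) plain) # ({l, l'}, w) # ({l, p}, plain) #
        ({l', p'}, plain) # ({a3, q}, plain) # ({p', b1}, plain) # ({b1, b2}, plain) #
        ({b2, b3}, plain) # ({b3, q'}, plain) # ?rest)
      = (y - 1) * ?Z (insert b1 (insert b2 (insert b3 (insert l (insert l' ?W))))) {}
            (({p, q}, ?h) # ({l, l'}, w) # ({l, p}, plain) # ({l', p'}, plain) #
            ({p', b1}, plain) # ({b1, b2}, plain) # ({b2, b3}, plain) # ({b3, q'}, plain) #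
            ?rest)"
    by (rule state_sum_series) (simp_all add: rules)
  have 4: "?Z (insert b1 (insert b2 (insert b3 (insert l (insert l' ?W))))) {}
        (({p, q}, ?h) # ({l, l'}, w) # ({l, p}, plain) # ({l', p'}, plain) # ({p', b1}, plain) #
        ({b1, b2}, plain) # ({b2, b3}, plain) # ({b3, q'}, plain) # ?rest)
      = (y - 1) * ?Z (insert b2 (insert b3 (insert l (insert l' ?W)))) {}
            (({p', b2}, series plain plain) # ({p, q}, ?h) # ({l, l'}, w) # ({l, p}, plain) #
            ({l', p'}, plain) # ({b2, b3}, plain) # ({b3, q'}, plain) # ?rest)"
    by (rule state_sum_series) (simp_all add: rules)
  have 5: "?Z (insert b2 (insert b3 (insert l (insert l' ?W)))) {}
        (({p', b2}, series plain plain) # ({p, q}, ?h) # ({l, l'}, w) # ({l, p}, plain) #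
        ({l', p'}, plain) # ({b2, b3}, plain) # ({b3, q'}, plain) # ?rest)
      = (y - 1) * ?Z (insert b3 (insert l (insert l' ?W))) {}
            (({p', b3}, series (series plain plain) plain) # ({p, q}, ?h) # ({l, l'}, w) #
            ({l, p}, plain) # ({l', p'}, plain) # ({b3, q'}, plain) # ?rest)"
    by (rule state_sum_series) (simp_all add: rules)
  have 6: "?Z (insert b3 (insert l (insert l' ?W))) {}
        (({p', b3}, series (series plain plain) plain) # ({p, q}, ?h) # ({l, l'}, w) #
        ({l, p}, plain) # ({l', p'}, plain) # ({b3, q'}, plain) # ?rest)
      = (y - 1) * ?Z (insert l (insert l' ?W)) {}
            (({p', q'}, ?h) # ({p, q}, ?h) # ({l, l'}, w) # ({l, p}, plain) # ({l', p'}, plain) #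
            ?rest)"
    by (rule state_sum_series) (simp_all add: rules)
  have 7: "?Z (insert l (insert l' ?W)) {} (({p', q'}, ?h) # ({p, q}, ?h) # ({l, l'}, w) #
        ({l, p}, plain) # ({l', p'}, plain) # ?rest)
      = (y - 1) * ?Z (insert l' ?W) {} (({p, l'}, series plain w) # ({p', q'}, ?h) #
            ({p, q}, ?h) # ({l', p'}, plain) # ?rest)"
    by (rule state_sum_series) (simp_all add: rules)
  have 8: "?Z (insert l' ?W) {} (({p, l'}, series plain w) # ({p', q'}, ?h) # ({p, q}, ?h) #
        ({l', p'}, plain) # ?rest)
      = (y - 1) * ?Z ?W {} (({p, p'}, series (series plain w) plain) # ({p', q'}, ?h) #
            ({p, q}, ?h) # ?rest)"
    by (rule state_sum_series) (simp_all add: rules)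
  have 9: "?Z ?W {} (({p, p'}, series (series plain w) plain) # ({p', q'}, ?h) # ({p, q}, ?h) #
        ?rest)
      = ?Z ?W {} (({m, m'}, plain) # ({p, p'}, series (series plain w) plain) # ({p', q'}, ?h) #
            ({p', m'}, plain) # ({m', q'}, plain) # ({p, q}, ?h) # ({p, m}, plain) #
            ({m, q}, plain) # ({q, r}, plain) # ({q', r'}, plain) # ({r, r'}, plain) # es)"
    by (rule state_sum_perm) simp
  have 10: "?Z ?W {} (({m, m'}, plain) # ({p, p'}, series (series plain w) plain) #
        ({p', q'}, ?h) # ({p', m'}, plain) # ({m', q'}, plain) # ({p, q}, ?h) # ({p, m}, plain) #
        ({m, q}, plain) # ({q, r}, plain) # ({q', r'}, plain) # ({r, r'}, plain) # es)
      = (y - 1) ^ 6 * ?Z V {} (({r, r'}, block_weight w) # es)"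
    unfolding block_weight_def by (rule core_reduction) (use V new es in simp_all)
  show ?thesis
    unfolding list.map append.simps 1 2 3 4 5 6 7 8 9 10 by (simp add: power_numeral_reduce mult.assoc)
qed

end

section \<open>The transfer matrix of a pyrene\<close>

text \<open>The deleted weight of a path of four edges, which is the outer boundary of the hexagons
  above and below the row.\<close>

definition path4 :: "'a :: comm_ring_1 \<Rightarrow> 'a" where
  "path4 x = 1 + x + x^2 + x^3"

text \<open>The linear map from the weight of \<open>p p'\<close> to the weight that the core induces between \<open>q\<close> and
  \<open>q'\<close>. In a name, the first word tells whether \<open>p p'\<close> is deleted or contracted, the second
  whether the entry belongs to the deleted or to the contracted component of the result. The
  sum that is squared in the first entry is the Tutte polynomial of a hexagon: deleting both
  \<open>p p'\<close> and \<open>m m'\<close> leaves two hexagons, one containing \<open>q\<close> and one containing \<open>q'\<close>.\<close>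

definition core_del_del :: "'a :: comm_ring_1 \<Rightarrow> 'a \<Rightarrow> 'a" where
  "core_del_del x y = (y + x + x^2 + x^3 + x^4 + x^5)^2
     + (x * path4 x + 1) * ((x + 1) * (x * path4 x + 1) + 2 * y)"

definition core_del_con :: "'a :: comm_ring_1 \<Rightarrow> 'a \<Rightarrow> 'a" where
  "core_del_con x y = (x * path4 x + 1 + y)^2"

definition core_con_del :: "'a :: comm_ring_1 \<Rightarrow> 'a \<Rightarrow> 'a" where
  "core_con_del x y = (x + 1) * path4 x * ((x^2 + 1) * path4 x + 2 * (x + y))
     + (x + 1) * path4 x * ((x - 1) * path4 x + 2)
     + (y + 1) * path4 x * ((x + 1) * path4 x + 2 * y)"

definition core_con_con :: "'a :: comm_ring_1 \<Rightarrow> 'a \<Rightarrow> 'a" where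
  "core_con_con x y = (path4 x + x + y)^2 + path4 x * ((x - 1) * path4 x + 2) + x + y
     + (y + 1) * (path4 x + y)^2"

text \<open>The same for a whole block without its right end edge. The path \<open>p l l' p'\<close> turns a weight
  \<open>(a, b)\<close> of \<open>l l'\<close> into \<open>(x^2 * a + (x + 1) * b, b)\<close>, and the path \<open>r q q' r'\<close> acts on the
  weight of \<open>q q'\<close> in the same way; the core is multiplied from both sides by the matrix of
  this map.\<close>

definition del_del :: "'a :: comm_ring_1 \<Rightarrow> 'a \<Rightarrow> 'a" where
  "del_del x y = x^2 * (x^2 * core_del_del x y + (x + 1) * core_del_con x y)"

definition con_del :: "'a :: comm_ring_1 \<Rightarrow> 'a \<Rightarrow> 'a" where
  "con_del x y = x^2 * ((x + 1) * core_del_del x y + core_con_del x y)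
     + (x + 1) * ((x + 1) * core_del_con x y + core_con_con x y)"

definition del_con :: "'a :: comm_ring_1 \<Rightarrow> 'a \<Rightarrow> 'a" where
  "del_con x y = x^2 * core_del_con x y"

definition con_con :: "'a :: comm_ring_1 \<Rightarrow> 'a \<Rightarrow> 'a" where
  "con_con x y = (x + 1) * core_del_con x y + core_con_con x y"

lemmas entry_defs = path4_def core_del_del_def core_del_con_def core_con_del_def core_con_con_def
  del_del_def con_del_def del_con_def con_con_def

text \<open>A block transforms weights linearly. The second component is not just that of the matrix
  above because the edge \<open>r r'\<close> is put in parallel: this turns \<open>(a, b)\<close> into
  \<open>(a, a + y * b)\<close>.\<close>

lemma block_weight_eq:
  fixes x y a b :: "'a :: idom"
  shows "block_weight x y (a, b) =
    (del_del x y * a + con_del x y * b,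
     del_del x y * a + con_del x y * b + y * (del_con x y * a + con_con x y * b))"
  unfolding block_weight_def core_weight_def attach_exits_def series_def parallel_def Let_def
    fst_conv snd_conv prod.inject entry_defs
  by (intro conjI; Groebner_Basis.algebra)

text \<open>These four combinations are the Tutte polynomials of a block with each of its two end edges
  contracted or deleted: a weight \<open>(a, b)\<close> between the two ends closes up to
  \<open>(x - 1) * a + b\<close> if the right end edge is deleted and to \<open>a + (y - 1) * b\<close> if it is
  contracted. The block looks the same from the left and from the right, so the two mixed
  ones coincide.\<close>

lemma both_ends_contracted:
  fixes x y :: "'a :: idom"
  shows "con_del x y + (y - 1) * con_con x y
    = x^13 + 4*x^12 + 10*x^11 + 20*x^10 + 2*x^9*y + 33*x^9 + 8*x^8*y + 46*x^8
           + 18*x^7*y + 56*x^7 + x^6*y^2 + 31*x^6*y + 60*x^6 + 6*x^5*y^2 + 42*x^5*y + 56*x^5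
           + 11*x^4*y^2 + 49*x^4*y + 44*x^4 + 2*x^3*y^3 + 17*x^3*y^2 + 44*x^3*y + 29*x^3
           + 2*x^2*y^3 + 17*x^2*y^2 + 34*x^2*y + 15*x^2 + 4*x*y^3 + 17*x*y^2 + 19*x*y + 4*x
           + y^4 + 5*y^3 + 8*y^2 + 4*y"
  unfolding entry_defs by Groebner_Basis.algebra

lemma left_end_deleted:
  fixes x y :: "'a :: idom"
  shows "del_del x y + (y - 1) * del_con x y
    = x^2 * (x^12 + 3*x^11 + 6*x^10 + 10*x^9 + x^8*y + 14*x^8 + 4*x^7*y + 16*x^7
           + 7*x^6*y + 16*x^6 + 10*x^5*y + 14*x^5 + 2*x^4*y^2 + 11*x^4*y + 10*x^4
           + 2*x^3*y^2 + 10*x^3*y + 6*x^3 + 3*x^2*y^2 + 7*x^2*y + 3*x^2 + 3*x*y^2 + 4*x*y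
           + x + y^3 + 2*y^2 + y)"
  unfolding entry_defs by Groebner_Basis.algebra

lemma right_end_deleted:
  fixes x y :: "'a :: idom"
  shows "(x - 1) * con_del x y + con_con x y
    = x^2 * (x^12 + 3*x^11 + 6*x^10 + 10*x^9 + x^8*y + 14*x^8 + 4*x^7*y + 16*x^7
           + 7*x^6*y + 16*x^6 + 10*x^5*y + 14*x^5 + 2*x^4*y^2 + 11*x^4*y + 10*x^4
           + 2*x^3*y^2 + 10*x^3*y + 6*x^3 + 3*x^2*y^2 + 7*x^2*y + 3*x^2 + 3*x*y^2 + 4*x*y
           + x + y^3 + 2*y^2 + y)"
  unfolding entry_defs by Groebner_Basis.algebra

lemma both_ends_deleted:
  fixes x y :: "'a :: idom"
  shows "(x - 1) * del_del x y + del_con x y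
    = x^5 * (x^5 + x^4 + x^3 + x^2 + x + y)^2"
  unfolding entry_defs by Groebner_Basis.algebra

section \<open>The pyrene chain as a sequence of blocks\<close>

text \<open>The side that the block around \<open>(t, 0)\<close> shares with the preceding block.\<close>

abbreviation gate :: "int \<Rightarrow> point set" where
  "gate t \<equiv> {(t - 1, 1), (t - 1, -1)}"

text \<open>The corners of the four hexagons around \<open>(t, 0)\<close>, \<open>(t + 2, 0)\<close>, \<open>(t + 1, 3)\<close>, \<open>(t + 1, -3)\<close>
  except the two rightmost ones, which belong to the next block, and their sides except the
  leftmost one. Both lists are in the order in which the corners and sides occur in
  \<open>block_reduction\<close>.\<close>

fun block_verts :: "int \<Rightarrow> point list" where
  "block_verts t = [(t, 4), (t + 1, 5), (t + 2, 4), (t, -4), (t + 1, -5), (t + 2, -4),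
     (t - 1, 1), (t - 1, -1), (t + 1, -1), (t, -2), (t + 1, 1), (t, 2), (t + 2, 2), (t + 2, -2)]"

fun block_edges :: "int \<Rightarrow> point set list" where
  "block_edges t =
     [{(t - 1, 1), (t, 2)}, {(t - 1, -1), (t, -2)},
      {(t, 2), (t, 4)}, {(t, 4), (t + 1, 5)}, {(t + 1, 5), (t + 2, 4)}, {(t + 2, 4), (t + 2, 2)},
      {(t, -2), (t, -4)}, {(t, -4), (t + 1, -5)}, {(t + 1, -5), (t + 2, -4)}, {(t + 2, -4), (t + 2, -2)},
      {(t + 1, 1), (t + 1, -1)}, {(t, -2), (t + 1, -1)}, {(t + 1, -1), (t + 2, -2)},
      {(t, 2), (t + 1, 1)}, {(t + 1, 1), (t + 2, 2)}, {(t + 2, 2), (t + 3, 1)}, {(t + 2, -2), (t + 3, -1)},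
      {(t + 3, 1), (t + 3, -1)}]"

primrec chain_verts :: "int \<Rightarrow> nat \<Rightarrow> point set" where
  "chain_verts t 0 = {(t - 1, 1), (t - 1, -1)}"
| "chain_verts t (Suc k) = set (block_verts t) \<union> chain_verts (t + 4) k"

primrec chain_edges :: "int \<Rightarrow> nat \<Rightarrow> point set list" where
  "chain_edges t 0 = []"
| "chain_edges t (Suc k) = block_edges t @ chain_edges (t + 4) k"

lemma gate_in_chain: "(t - 1, 1) \<in> chain_verts t k" "(t - 1, -1) \<in> chain_verts t k"
  by (cases k; simp)+

lemma gate_in_next_chain:
  "(t + 3, 1) \<in> chain_verts (t + 4) k" "(t + 3, -1) \<in> chain_verts (t + 4) k"
  using gate_in_chain[of "t + 4" k] by (simp_all add: add.commute)

lemma chain_verts_fst: "v \<in> chain_verts t k \<Longrightarrow> t - 1 \<le> fst v"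
  by (induction k arbitrary: t) fastforce+

lemma block_verts_notin: "set (block_verts t) \<inter> chain_verts (t + 4) k = {}"
  using chain_verts_fst[of _ "t + 4" k] by fastforce

lemma distinct_block_verts: "distinct (block_verts t)"
  by simp

lemma finite_chain_verts: "finite (chain_verts t k)"
  by (induction k arbitrary: t) simp_all

lemma card_chain_verts: "card (chain_verts t k) = 14 * k + 2"
proof (induction k arbitrary: t)
  case (Suc k)
  have "card (set (block_verts t)) = 14"
    using distinct_card[OF distinct_block_verts[of t]] by simp
  then show ?case
    using Suc card_Un_disjoint[OF _ finite_chain_verts block_verts_notin, of t k] by simp
qed simp

lemma chain_edges_on: "e \<in> set (chain_edges t k) \<Longrightarrow> edge_on (chain_verts t k) e"
proof (induction k arbitrary: t)
  case (Suc k)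
  from Suc.prems consider "e \<in> set (block_edges t)" | "e \<in> set (chain_edges (t + 4) k)"
    by (simp only: chain_edges.simps set_append Un_iff) blast
  then show ?case
  proof cases
    case 1
    then show ?thesis
      using gate_in_next_chain[of t k] by (auto simp del: One_nat_def)
  next
    case 2
    show ?thesis
      by (rule edge_on_mono[OF Suc.IH[OF 2]]) (simp del: block_verts.simps)
  qed
qed simp

text \<open>Adding up the abscissae of the two ends of a side separates the blocks from each other.\<close>

lemma chain_edges_abscissae: "e \<in> set (chain_edges t k) \<Longrightarrow> 2 * t - 1 \<le> sum fst e"
proof (induction k arbitrary: t)
  case (Suc k)
  then show ?case by force
qed simp

lemma distinct_chain_edges: "distinct (gate t # chain_edges t k)"
proof -
  have "distinct (chain_edges t k)" for t
  proof (induction k arbitrary: t)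
    case (Suc k)
    have "distinct (block_edges t)" by (simp add: doubleton_eq_iff)
    moreover have "sum fst e < 2 * (t + 4) - 1" if "e \<in> set (block_edges t)" for e
      using that by auto
    then have "set (block_edges t) \<inter> set (chain_edges (t + 4) k) = {}"
      using chain_edges_abscissae[of _ "t + 4" k] by fastforce
    ultimately show ?case using Suc by (simp del: block_edges.simps)
  qed simp
  moreover have "gate t \<notin> set (chain_edges t k)"
    using chain_edges_abscissae[of "gate t" t k] by auto
  ultimately show ?thesis by simp
qed

lemma walk_reaches:
  assumes "successively (\<lambda>a b. {a, b} \<in> F) (s # us)" "u \<in> set us"
  shows "(s, u) \<in> {(a, b). {a, b} \<in> F}\<^sup>*"
  using assms
proof (induction us arbitrary: s)
  case (Cons u' us)
  then have "(s, u') \<in> {(a, b). {a, b} \<in> F}" by simp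
  then show ?case
    using Cons by (auto intro: converse_rtrancl_into_rtrancl)
qed simp

lemma chain_connected:
  assumes "insert (gate t) (set (chain_edges t k)) \<subseteq> F" "u \<in> chain_verts t k"
  shows "((t - 1, 1), u) \<in> {(a, b). {a, b} \<in> F}\<^sup>*"
  using assms
proof (induction k arbitrary: t)
  case 0
  then show ?case by auto
next
  case (Suc k)
  \<comment> \<open>a walk from the leftmost to the rightmost side that visits all corners of the block but the last\<close>
  let ?walk = "[(t - 1, -1), (t, -2), (t, -4), (t + 1, -5), (t + 2, -4), (t + 2, -2), (t + 1, -1),
    (t + 1, 1), (t, 2), (t, 4), (t + 1, 5), (t + 2, 4), (t + 2, 2), (t + 3, 1)]"
  have walk: "successively (\<lambda>a b. {a, b} \<in> F) ((t - 1, 1) # ?walk)"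
    using Suc.prems(1) by (simp add: insert_commute)
  have next_gate: "((t - 1, 1), (t + 3, 1)) \<in> {(a, b). {a, b} \<in> F}\<^sup>*"
    by (rule walk_reaches[OF walk]) simp
  from Suc.prems(2) consider "u = (t - 1, 1)" | "u \<in> set ?walk" | "u \<in> chain_verts (t + 4) k"
    by auto
  then show ?case
  proof cases
    case 2
    then show ?thesis by (rule walk_reaches[OF walk])
  next
    case 3
    have "insert (gate (t + 4)) (set (chain_edges (t + 4) k)) \<subseteq> F"
      using Suc.prems(1) by (simp add: add.commute)
    from Suc.IH[OF this 3] next_gate show ?thesis by (simp add: add.commute)
  qed simp
qed

lemma ncomp_chain: "ncomp (chain_verts t k) (set (gate t # chain_edges t k)) = 1"
proof -
  let ?V = "chain_verts t k" and ?F = "set (gate t # chain_edges t k)"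
  have "((t - 1, 1), u) \<in> linked ?V ?F" if "u \<in> ?V" for u
    using chain_connected[of t k ?F u] gate_in_chain[of t k] that by (simp add: linked_def)
  then have "linked ?V ?F `` {u} = ?V" if "u \<in> ?V" for u
    using equiv_class_eq[OF equiv_linked, of "(t - 1, 1)" u ?V ?F] that
    by (auto simp: linked_def)
  then have "?V // linked ?V ?F = {?V}"
    using gate_in_chain(1)[of t k] by (auto simp: quotient_def)
  then show ?thesis by (simp add: ncomp_def)
qed

text \<open>The blocks are swallowed one after the other from the left. In the end only the rightmost
  side is left, and its weight is the image of \<open>w\<close> under the \<open>k\<close>-th iterate of
  \<open>block_weight\<close>.\<close>

lemma state_sum_chain:
  "state_sum x y (chain_verts t k) {} ((gate t, w) # map (\<lambda>e. (e, 1, 1)) (chain_edges t k))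
    = (y - 1) ^ (14 * k) * state_sum x y (gate (t + 4 * int k)) {}
        [(gate (t + 4 * int k), (block_weight x y ^^ k) w)]"
proof (induction k arbitrary: t w)
  case (Suc k)
  let ?es = "map (\<lambda>e. (e, 1, 1)) (chain_edges (t + 4) k)"
  have on: "edges_on (chain_verts (t + 4) k) ?es"
    by (auto simp: edges_on_def chain_edges_on)
  have "state_sum x y (chain_verts t (Suc k)) {}
      ((gate t, w) # map (\<lambda>e. (e, 1, 1)) (chain_edges t (Suc k)))
    = (y - 1) ^ 14 * state_sum x y (chain_verts (t + 4) k) {}
        (({(t + 3, 1), (t + 3, -1)}, block_weight x y w) # ?es)"
    unfolding chain_verts.simps chain_edges.simps map_append block_edges.simps block_verts.simps
      list.set Un_insert_left Un_empty_left
    by (rule block_reduction[OF finite_chain_verts gate_in_next_chain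
      distinct_block_verts[unfolded block_verts.simps] block_verts_notin[unfolded block_verts.simps] on])
  also have "{(t + 3, 1), (t + 3, -1)} = gate (t + 4)" by (simp add: add.commute)
  also note Suc.IH
  also have "t + 4 + 4 * int k = t + 4 * int (Suc k)" by simp
  finally show ?case
    by (simp only: funpow_Suc_right comp_apply mult_Suc_right power_add mult.assoc)
qed simp

lemma state_sum_gate:
  "state_sum x y (gate t) {} [(gate t, w)]
    = (x - 1) * (y - 1) ^ 2 * ((x - 1) * fst w + snd w)"
proof -
  have "state_sum x y (gate t) {} [(gate t, w)]
     = fst w * state_sum x y (gate t) {} [] + (y - 1) * snd w * state_sum x y {(t - 1, -1) :: point} {} []"
    using state_sum_delete_contract[of "[(gate t, w)]" "(t - 1, -1)" "(t - 1, 1)" w "[]" "{(t - 1, -1)}" x y]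
    by (simp add: insert_commute identify_in_def)
  then show ?thesis
    by (simp add: ncomp_empty algebra_simps power2_eq_square)
qed

text \<open>The inductions include the leftmost side explicitly: it is all that a chain of length 0
  consists of, whereas no hexagons have no corners and sides. Any hexagon at the start makes
  the difference disappear.\<close>

lemma pyrene_chain_eq:
  assumes "n \<ge> 1"
  shows "pyrene_chain n = \<lparr>verts = chain_verts 4 n, edges = set (gate 4 # chain_edges 4 n), ends = (\<lambda>e. e)\<rparr>"
proof -
  let ?H = "\<lambda>i. {hex_u i, hex_w i, hex_a i, hex_b i}"
  have V: "chain_verts (4 * int i) k
      = gate (4 * int i) \<union> (\<Union>c\<in>(\<Union>j\<in>{i..<i + k}. ?H j). hexagon_corners c)" for i k
  proof (induction k arbitrary: i)
    case (Suc k)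
    let ?t = "4 * int i"
    have "{i..<i + Suc k} = insert i {Suc i..<Suc i + k}" by auto
    then have "gate ?t \<union> (\<Union>c\<in>(\<Union>j\<in>{i..<i + Suc k}. ?H j). hexagon_corners c)
      = (gate ?t \<union> (\<Union>c\<in>?H i. hexagon_corners c)) \<union> (\<Union>c\<in>(\<Union>j\<in>{Suc i..<Suc i + k}. ?H j). hexagon_corners c)"
      by (simp only: UN_insert UN_Un UN_empty Un_empty_right Un_assoc)
    also have "gate ?t \<union> (\<Union>c\<in>?H i. hexagon_corners c) = set (block_verts ?t) \<union> gate (?t + 4)"
      by (rule subset_antisym; simp add: hex_u_def hex_w_def hex_a_def hex_b_def)
    finally show ?case
      using Suc[of "Suc i"] by (simp add: Un_assoc algebra_simps del: block_verts.simps)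
  qed simp
  have E: "insert (gate (4 * int i)) (set (chain_edges (4 * int i) k))
      = insert (gate (4 * int i)) (\<Union>c\<in>(\<Union>j\<in>{i..<i + k}. ?H j). hexagon_sides c)" for i k
  proof (induction k arbitrary: i)
    case (Suc k)
    let ?t = "4 * int i"
    have "{i..<i + Suc k} = insert i {Suc i..<Suc i + k}" by auto
    then have "insert (gate ?t) (\<Union>c\<in>(\<Union>j\<in>{i..<i + Suc k}. ?H j). hexagon_sides c)
      = insert (gate ?t) (\<Union>c\<in>?H i. hexagon_sides c) \<union> (\<Union>c\<in>(\<Union>j\<in>{Suc i..<Suc i + k}. ?H j). hexagon_sides c)"
      by (simp only: UN_insert UN_Un UN_empty Un_empty_left Un_insert_left Un_assoc)
    also have "insert (gate ?t) (\<Union>c\<in>?H i. hexagon_sides c) = insert (gate ?t) (set (block_edges ?t)) \<union> {gate (?t + 4)}"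
      by (rule subset_antisym; simp add: hex_u_def hex_w_def hex_a_def hex_b_def doubleton_eq_iff)
    finally have sides: "insert (gate ?t) (\<Union>c\<in>(\<Union>j\<in>{i..<i + Suc k}. ?H j). hexagon_sides c)
      = insert (gate ?t) (set (block_edges ?t)) \<union> insert (gate (?t + 4))
          (\<Union>c\<in>(\<Union>j\<in>{Suc i..<Suc i + k}. ?H j). hexagon_sides c)"
      by (simp only: Un_assoc Un_insert_left Un_empty_left)
    have "gate (?t + 4) \<in> set (block_edges ?t)" by (simp add: add.commute)
    then have "insert (gate ?t) (set (chain_edges ?t (Suc k)))
      = insert (gate ?t) (set (block_edges ?t)) \<union> insert (gate (?t + 4)) (set (chain_edges (?t + 4) k))"
      unfolding chain_edges.simps set_append by blast
    moreover have "4 * int (Suc i) = ?t + 4" by simp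
    ultimately show ?case
      using Suc[of "Suc i"] sides by (simp only:)
  qed simp
  let ?C = "\<Union>j\<in>{1..n}. ?H j"
  have n: "{1..<1 + n} = {1..n}" by auto
  have u: "hex_u 1 \<in> ?C" using assms by auto
  have "gate 4 \<subseteq> hexagon_corners (hex_u 1)" by (simp add: hex_u_def)
  then have "gate 4 \<subseteq> (\<Union>c\<in>?C. hexagon_corners c)" using u by blast
  then have "chain_verts 4 n = (\<Union>c\<in>?C. hexagon_corners c)"
    using V[of 1 n, unfolded n] by (simp only: Un_absorb1 of_nat_1 mult_1_right)
  moreover have "gate 4 \<in> hexagon_sides (hex_u 1)" by (simp add: hex_u_def insert_commute)
  then have "gate 4 \<in> (\<Union>c\<in>?C. hexagon_sides c)" using u by blast
  then have "set (gate 4 # chain_edges 4 n) = (\<Union>c\<in>?C. hexagon_sides c)"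
    using E[of 1 n, unfolded n] by (simp only: insert_absorb of_nat_1 mult_1_right list.set)
  ultimately show ?thesis
    by (simp only: pyrene_chain_def hexagon_graph_def)
qed

section \<open>Recurrences of order two\<close>

text \<open>The Lucas sequence with parameters \<open>p\<close> and \<open>- q\<close>. It is the fundamental solution of the
  recurrence, and both formulas of the theorem express it.\<close>

fun lucas :: "'a :: comm_ring_1 \<Rightarrow> 'a \<Rightarrow> nat \<Rightarrow> 'a" where
  "lucas p q 0 = 0"
| "lucas p q (Suc 0) = 1"
| "lucas p q (Suc (Suc n)) = p * lucas p q (Suc n) + q * lucas p q n"

lemma recurrence_eq_lucas:
  fixes t :: "nat \<Rightarrow> 'a :: comm_ring_1"
  assumes "\<And>k. t (Suc (Suc k)) = p * t (Suc k) + q * t k"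
  shows "t (Suc n) = t 1 * lucas p q (Suc n) + q * t 0 * lucas p q n"
proof (induction n rule: induct_nat_012)
  case (ge2 n)
  show ?case
    unfolding assms[of "Suc n"] ge2 by (simp add: algebra_simps)
qed (simp_all add: assms algebra_simps)

lemma binet_lucas:
  fixes a b :: "'a :: field"
  assumes "a \<noteq> b" "a + b = p" "a * b = - q"
  shows "(a ^ n - b ^ n) / (a - b) = lucas p q n"
proof -
  have pq: "p = a + b" "q = - (a * b)" using assms(2,3) by simp_all
  have "a ^ n - b ^ n = (a - b) * lucas p q n"
  proof (induction n rule: induct_nat_012)
    case (ge2 n)
    have "a ^ Suc (Suc n) - b ^ Suc (Suc n)
        = (a + b) * (a ^ Suc n - b ^ Suc n) - a * b * (a ^ n - b ^ n)"
      by (simp add: algebra_simps)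
    then show ?case
      unfolding ge2 by (simp add: pq algebra_simps)
  qed simp_all
  then show ?thesis using assms(1) by simp
qed

text \<open>Pascal's rule turns the recurrence of the summands into that of the sequence. The summands
  with \<open>2 * j \<ge> n\<close> vanish through their binomial coefficient, which makes the truncated
  exponents harmless.\<close>

lemma lucas_eq_sum:
  "lucas p q n = (\<Sum>j | 2 * j + 1 \<le> n. of_nat ((n - j - 1) choose j) * p ^ (n - 2 * j - 1) * q ^ j)"
proof (cases n)
  case (Suc m)
  define tm where "tm m j = of_nat ((m - j) choose j) * p ^ (m - 2 * j) * q ^ j" for m j
  have Suc_tm: "tm (Suc (Suc m)) (Suc i) = p * tm (Suc m) (Suc i) + q * tm m i" if "i \<le> m" for m i
  proof (cases "2 * i + 1 \<le> m")
    case True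
    then have "m - 2 * i = Suc (m - Suc (2 * i))" by simp
    then show ?thesis using that by (simp add: tm_def Suc_diff_le algebra_simps)
  next
    case False
    then have zero: "(m - i) choose Suc i = 0" by (intro binomial_eq_0) simp
    show ?thesis using that by (simp add: zero tm_def Suc_diff_le algebra_simps)
  qed
  have "lucas p q (Suc m) = (\<Sum>j\<le>m. tm m j)" for m
  proof (induction m rule: induct_nat_012)
    case (ge2 m)
    have "(\<Sum>j\<le>Suc (Suc m). tm (Suc (Suc m)) j)
      = p * tm (Suc m) 0 + (\<Sum>i\<le>m. p * tm (Suc m) (Suc i) + q * tm m i)"
      (is "sum ?f _ = _")
    proof -
      have "sum ?f {..Suc (Suc m)} = ?f 0 + (\<Sum>i\<le>Suc m. ?f (Suc i))"
        by (rule sum.atMost_Suc_shift)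
      also have "(\<Sum>i\<le>Suc m. ?f (Suc i)) = (\<Sum>i\<le>m. ?f (Suc i))"
        by (simp add: tm_def)
      also have "\<dots> = (\<Sum>i\<le>m. p * tm (Suc m) (Suc i) + q * tm m i)"
        by (rule sum.cong) (simp_all add: Suc_tm)
      finally show ?thesis by (simp add: tm_def)
    qed
    also have "\<dots> = p * (\<Sum>j\<le>Suc m. tm (Suc m) j) + q * (\<Sum>j\<le>m. tm m j)"
      unfolding sum.atMost_Suc_shift[of _ m] by (simp add: sum.distrib sum_distrib_left algebra_simps)
    finally show ?case using ge2 by simp
  qed (simp_all add: tm_def)
  also have "(\<Sum>j\<le>m. tm m j) = (\<Sum>j | 2 * j + 1 \<le> n. tm m j)"
  proof (rule sum.mono_neutral_right)
    show "\<forall>i\<in>{..m} - {j. 2 * j + 1 \<le> n}. tm m i = 0"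
    proof
      fix i assume "i \<in> {..m} - {j. 2 * j + 1 \<le> n}"
      then have zero: "(m - i) choose i = 0" by (intro binomial_eq_0) (auto simp: Suc)
      show "tm m i = 0" by (simp add: zero tm_def)
    qed
  qed (auto simp: Suc)
  finally show ?thesis by (simp add: Suc tm_def)
qed simp

lemma sum_index_sets:
  "{j. int j \<le> \<lfloor>(real n - 1) / 2\<rfloor>} = {j. 2 * j + 1 \<le> n}"
  "{j. int j \<le> \<lfloor>(real n - 2) / 2\<rfloor>} = {j. 2 * j + 1 \<le> n - 1}"
  by (auto simp: le_floor_iff field_simps)

section \<open>Nonvanishing of the discriminant\<close>

text \<open>The discriminant of the characteristic polynomial of the matrix in \<open>block_weight_eq\<close>.\<close>

definition discriminant :: "'a :: comm_ring_1 \<Rightarrow> 'a \<Rightarrow> 'a" where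
  "discriminant x y = (y * con_con x y - (del_del x y + con_del x y))^2
     + 4 * con_del x y * (y * (con_con x y + del_con x y))"

definition to_closure :: "int poly poly \<Rightarrow> Qxy_closure" where
  "to_closure P = to_ac (to_fract P)"

lemma to_closure_simps [simp]:
  "to_closure (P + Q) = to_closure P + to_closure Q" "to_closure (P - Q) = to_closure P - to_closure Q"
  "to_closure (P * Q) = to_closure P * to_closure Q" "to_closure (P ^ n) = to_closure P ^ n"
  "to_closure 0 = 0" "to_closure 1 = 1" "to_closure (numeral k) = numeral k"
proof -
  have of_nat: "to_fract (of_nat n) = (of_nat n :: int poly poly fract)" for n
    by (induction n) simp_all
  have "to_fract (P ^ n) = to_fract P ^ n"
    by (induction n) simp_all
  then show "to_closure (P ^ n) = to_closure P ^ n" by (simp add: to_closure_def)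
  show "to_closure (numeral k) = numeral k"
    using of_nat[of "numeral k"] by (simp add: to_closure_def)
qed (simp_all add: to_closure_def)

lemma to_closure_eq_0_iff [simp]: "to_closure P = 0 \<longleftrightarrow> P = 0"
  by (simp add: to_closure_def)

lemma to_closure_nonzero: "poly (poly P [:b:]) a \<noteq> 0 \<Longrightarrow> to_closure P \<noteq> 0"
  by auto

text \<open>A polynomial expression in the two indeterminates is nonzero as soon as its value at some
  pair of integers is. The discriminant has the value 16 at the origin, since \<open>y\<close> and
  \<open>del_del\<close> vanish there and \<open>con_del\<close> is 4.\<close>

lemma generic_nonzero:
  "var_x - 1 \<noteq> 0" "var_y - 1 \<noteq> 0" "var_x * var_y - var_x - var_y \<noteq> 0"
  "(2 :: Qxy_closure) \<noteq> 0" "discriminant var_x var_y \<noteq> 0"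
proof -
  define a b :: "int poly poly" where "a = [:[:0, 1:]:]" and "b = [:0, 1:]"
  have xy: "var_x = to_closure a" "var_y = to_closure b"
    by (simp_all add: a_def b_def to_closure_def var_x_def var_y_def)
  have ev: "poly (poly a [:s:]) r = r" "poly (poly b [:s:]) r = s" for r s
    by (simp_all add: a_def b_def)
  note ev = this this[where s = 0, simplified]
  show "var_x - 1 \<noteq> 0"
    using to_closure_nonzero[of "a - 1" 0 0] by (simp add: xy ev)
  show "var_y - 1 \<noteq> 0"
    using to_closure_nonzero[of "b - 1" 0 0] by (simp add: xy ev)
  show "var_x * var_y - var_x - var_y \<noteq> 0"
    using to_closure_nonzero[of "a * b - a - b" 1 0] by (simp add: xy ev)
  show "(2 :: Qxy_closure) \<noteq> 0"
    using to_closure_nonzero[of 2 0 0] by simp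
  have "discriminant var_x var_y = to_closure (discriminant a b)"
    by (simp add: discriminant_def entry_defs xy)
  moreover have "poly (poly (discriminant a b) [:0:]) 0 \<noteq> 0"
    by (simp add: discriminant_def entry_defs ev)
  ultimately show "discriminant var_x var_y \<noteq> 0"
    using to_closure_nonzero by metis
qed

section \<open>The Tutte polynomial of the pyrene chain\<close>

text \<open>The Tutte polynomial of \<open>k\<close> blocks is a linear functional of the \<open>k\<close>-th power of the matrix
  in \<open>block_weight_eq\<close>. By the Cayley-Hamilton theorem it satisfies the recurrence whose
  coefficients are the trace and the negated determinant of the matrix; the index 0 stands
  for a single edge.\<close>

lemma iterate_block_weight:
  fixes x y :: "'a :: idom"
  defines "t \<equiv> \<lambda>k. (x - 1) * fst ((block_weight x y ^^ k) (1, 1)) + snd ((block_weight x y ^^ k) (1, 1))"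
  shows "t 0 = x"
    and "t 1 = x * (del_del x y + con_del x y) + y * (del_con x y + con_con x y)"
    and "t (Suc (Suc k)) = (del_del x y + con_del x y + y * con_con x y) * t (Suc k)
      + y * (con_del x y * del_con x y - del_del x y * con_con x y) * t k"
proof -
  show "t 0 = x" by (simp add: t_def)
  show "t 1 = x * (del_del x y + con_del x y) + y * (del_con x y + con_con x y)"
    by (simp add: t_def block_weight_eq algebra_simps)
  obtain a b where w: "(block_weight x y ^^ k) (1, 1) = (a, b)" by (cases "(block_weight x y ^^ k) (1, 1)")
  show "t (Suc (Suc k)) = (del_del x y + con_del x y + y * con_con x y) * t (Suc k)
      + y * (con_del x y * del_con x y - del_del x y * con_con x y) * t k"
    by (simp add: t_def block_weight_eq w) Groebner_Basis.algebra
qed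

text \<open>The chain is connected and has \<open>14 * n + 2\<close> vertices. All powers of \<open>x - 1\<close> and \<open>y - 1\<close> that
  the reductions produce cancel against those that relate the state sum to the Tutte
  polynomial.\<close>

lemma tutte_pyrene_chain:
  fixes x y :: "'a :: idom"
  assumes "n \<ge> 1" "x \<noteq> 1" "y \<noteq> 1"
  shows "tutte (pyrene_chain n) x y
    = (x - 1) * fst ((block_weight x y ^^ n) (1, 1)) + snd ((block_weight x y ^^ n) (1, 1))"
proof -
  let ?w = "(block_weight x y ^^ n) (1, 1)"
  have on: "\<forall>e\<in>set (gate 4 # chain_edges 4 n). edge_on (chain_verts 4 n) e"
    using chain_edges_on[of _ 4 n] gate_in_chain[of 4 n] by simp
  have "(x - 1) * (y - 1) ^ (14 * n + 2) * tutte (pyrene_chain n) x y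
    = state_sum x y (chain_verts 4 n) {} (map (\<lambda>e. (e, 1, 1)) (gate 4 # chain_edges 4 n))"
    using tutte_eq_state_sum[OF finite_chain_verts[of 4 n] distinct_chain_edges[of 4 n] on, of x y]
    unfolding ncomp_chain card_chain_verts power_one_right pyrene_chain_eq[OF assms(1)] .
  also have "\<dots> = (y - 1) ^ (14 * n) * ((x - 1) * (y - 1) ^ 2 * ((x - 1) * fst ?w + snd ?w))"
    unfolding list.map state_sum_chain state_sum_gate ..
  also have "\<dots> = (x - 1) * (y - 1) ^ (14 * n + 2) * ((x - 1) * fst ?w + snd ?w)"
    by (simp add: power_add power2_eq_square)
  finally show ?thesis using assms by simp
qed

theorem corollary4p3:
  fixes n :: nat
    and x y I J K A B C D s l\<^sub>1 l\<^sub>2 :: Qxy_closure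
  assumes "n \<ge> 1"
    and "x = var_x" and "y = var_y"
    and "I = x^13 + 4*x^12 + 10*x^11 + 20*x^10 + 2*x^9*y + 33*x^9 + 8*x^8*y + 46*x^8
           + 18*x^7*y + 56*x^7 + x^6*y^2 + 31*x^6*y + 60*x^6 + 6*x^5*y^2 + 42*x^5*y + 56*x^5
           + 11*x^4*y^2 + 49*x^4*y + 44*x^4 + 2*x^3*y^3 + 17*x^3*y^2 + 44*x^3*y + 29*x^3
           + 2*x^2*y^3 + 17*x^2*y^2 + 34*x^2*y + 15*x^2 + 4*x*y^3 + 17*x*y^2 + 19*x*y + 4*x
           + y^4 + 5*y^3 + 8*y^2 + 4*y"
    and "J = x^2 * (x^12 + 3*x^11 + 6*x^10 + 10*x^9 + x^8*y + 14*x^8 + 4*x^7*y + 16*x^7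
           + 7*x^6*y + 16*x^6 + 10*x^5*y + 14*x^5 + 2*x^4*y^2 + 11*x^4*y + 10*x^4
           + 2*x^3*y^2 + 10*x^3*y + 6*x^3 + 3*x^2*y^2 + 7*x^2*y + 3*x^2 + 3*x*y^2 + 4*x*y
           + x + y^3 + 2*y^2 + y)"
    and "K = x^5 * (x^5 + x^4 + x^3 + x^2 + x + y)^2"
    and "A = y * ((x - 1) * I - J) / (x*y - x - y)"
    and "C = y * ((x - 1) * (I + J) - (J + K)) / (x*y - x - y)"
    and "B = ((y - 1) * J - I) / (x*y - x - y)"
    and "D = ((y - 1) * (J + K) - (I + J)) / (x*y - x - y)"
    and "s^2 = (A - D)^2 + 4*B*C"
    and "l\<^sub>1 = (A + D + s) / 2" and "l\<^sub>2 = (A + D - s) / 2"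
  shows "tutte (pyrene_chain n) x y =
           (I + 2*J + K) * ((l\<^sub>1^n - l\<^sub>2^n) / (l\<^sub>1 - l\<^sub>2))
           + (C * (I + J) - A * (I + 2*J + K)) * ((l\<^sub>1^(n - 1) - l\<^sub>2^(n - 1)) / (l\<^sub>1 - l\<^sub>2))
         \<and> tutte (pyrene_chain n) x y =
           (I + 2*J + K) *
             (\<Sum>j | int j \<le> \<lfloor>(real n - 1) / 2\<rfloor>.
                of_nat ((n - j - 1) choose j) * (A + D)^(n - 2*j - 1) * (B*C - A*D)^j)
           + (C * (I + J) - A * (I + 2*J + K)) *
             (\<Sum>j | int j \<le> \<lfloor>(real n - 2) / 2\<rfloor>.
                of_nat ((n - j - 2) choose j) * (A + D)^(n - 2*j - 2) * (B*C - A*D)^j)"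
proof -
  note x = \<open>x = var_x\<close> and y = \<open>y = var_y\<close>
  define p q r t where "p = del_del x y" and "q = con_del x y" and "r = del_con x y" and "t = con_con x y"
  have IJK: "I = q + (y - 1) * t" "J = p + (y - 1) * r" "J = (x - 1) * q + t" "K = (x - 1) * p + r"
    unfolding p_def q_def r_def t_def assms(4-6) by (simp_all only: both_ends_contracted left_end_deleted right_end_deleted both_ends_deleted)
  have nz: "x - 1 \<noteq> 0" "y - 1 \<noteq> 0" "x * y - x - y \<noteq> 0" "(2 :: Qxy_closure) \<noteq> 0" "discriminant x y \<noteq> 0"
    unfolding x y by (rule generic_nonzero)+
  have IJ: "I + J = x * q + y * t" by (simp only: IJK(1) IJK(3)) (simp add: algebra_simps)
  have JK: "J + K = x * p + y * r" by (simp only: IJK(2) IJK(4)) (simp add: algebra_simps)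
  have prt: "(y - 1) * K - J = (x * y - x - y) * p" "(x - 1) * J - K = (x * y - x - y) * r"
    by (simp_all add: IJK(2,4) algebra_simps)
  have qt: "(y - 1) * J - I = (x * y - x - y) * q" "(x - 1) * I - J = (x * y - x - y) * t"
    by (simp_all add: IJK(1,3) algebra_simps)
  \<comment> \<open>The common factor \<open>x * y - x - y\<close> of the numerators is \<open>(x - 1) * (y - 1) - 1\<close>, up to sign the
    determinant of the system that expresses \<open>I\<close>, \<open>J\<close>, \<open>K\<close> by the matrix entries.\<close>
  have A: "A = y * t" and B: "B = q"
    unfolding assms(7,9) qt using nz(3) by simp_all
  have "y * ((x - 1) * (I + J) - (J + K)) = y * (((x - 1) * I - J) + ((x - 1) * J - K))"
    by (simp add: algebra_simps)
  also have "\<dots> = (x * y - x - y) * (y * (r + t))"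
    unfolding prt qt by (simp add: algebra_simps)
  finally have numerator_C: "y * ((x - 1) * (I + J) - (J + K)) = (x * y - x - y) * (y * (r + t))" .
  have C: "C = y * (r + t)" unfolding assms(8) numerator_C using nz(3) by simp
  have "(y - 1) * (J + K) - (I + J) = ((y - 1) * J - I) + ((y - 1) * K - J)"
    by (simp add: algebra_simps)
  also have "\<dots> = (x * y - x - y) * (p + q)"
    unfolding prt qt by (simp add: algebra_simps)
  finally have numerator_D: "(y - 1) * (J + K) - (I + J) = (x * y - x - y) * (p + q)" .
  have D: "D = p + q" unfolding assms(10) numerator_D using nz(3) by simp
  define T where "T k = (x - 1) * fst ((block_weight x y ^^ k) (1, 1)) + snd ((block_weight x y ^^ k) (1, 1))" for k
  have T: "T 0 = x" "T 1 = x * (p + q) + y * (r + t)"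
    "T (Suc (Suc k)) = (p + q + y * t) * T (Suc k) + y * (q * r - p * t) * T k" for k
    unfolding T_def p_def q_def r_def t_def by (rule iterate_block_weight)+
  have trace: "p + q + y * t = A + D" and det: "y * (q * r - p * t) = B * C - A * D"
    by (simp_all add: A B C D algebra_simps)
  have IJK_sum: "I + 2 * J + K = (I + J) + (J + K)" by simp
  have T1: "T 1 = I + 2 * J + K"
    unfolding T(2) IJK_sum IJ JK by (simp add: algebra_simps)
  \<comment> \<open>Extending the recurrence to the index 0 explains the second coefficient in the theorem.\<close>
  have T0: "(B * C - A * D) * T 0 = C * (I + J) - A * (I + 2 * J + K)"
    unfolding T(1) IJK_sum IJ JK A B C D by (simp add: algebra_simps)
  have "tutte (pyrene_chain n) x y = T n"
    unfolding T_def using tutte_pyrene_chain \<open>n \<ge> 1\<close> nz by simp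
  also have "\<dots> = T 1 * lucas (A + D) (B * C - A * D) n
      + (B * C - A * D) * T 0 * lucas (A + D) (B * C - A * D) (n - 1)"
    using recurrence_eq_lucas[of T, OF T(3), of "n - 1"] \<open>n \<ge> 1\<close> by (simp add: trace det)
  finally have tutte: "tutte (pyrene_chain n) x y
    = (I + 2 * J + K) * lucas (A + D) (B * C - A * D) n
      + (C * (I + J) - A * (I + 2 * J + K)) * lucas (A + D) (B * C - A * D) (n - 1)"
    unfolding T1 T0 .
  have disc: "s\<^sup>2 = discriminant x y"
    unfolding \<open>s^2 = (A - D)^2 + 4*B*C\<close> A B C D discriminant_def p_def q_def r_def t_def
    by (simp add: algebra_simps)
  have l: "2 * l\<^sub>1 = A + D + s" "2 * l\<^sub>2 = A + D - s"
    using nz(4) unfolding assms(12,13) by simp_all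
  have "2 * 2 * (l\<^sub>1 * l\<^sub>2) = (2 * l\<^sub>1) * (2 * l\<^sub>2)" by (simp add: algebra_simps)
  also have "\<dots> = (A + D)^2 - s^2" unfolding l by (simp add: algebra_simps power2_eq_square)
  also have "\<dots> = 2 * 2 * - (B * C - A * D)"
    unfolding \<open>s^2 = (A - D)^2 + 4*B*C\<close> by (simp add: algebra_simps power2_eq_square)
  finally have prod: "l\<^sub>1 * l\<^sub>2 = - (B * C - A * D)"
    using nz(4) by (metis mult_cancel_left mult_eq_0_iff)
  have "l\<^sub>1 - l\<^sub>2 = s" "l\<^sub>1 + l\<^sub>2 = A + D"
    using nz(4) unfolding assms(12,13) by (simp_all add: field_simps)
  moreover have "s \<noteq> 0" using disc nz(5) by auto
  moreover note prod
  ultimately have binet: "(l\<^sub>1 ^ k - l\<^sub>2 ^ k) / (l\<^sub>1 - l\<^sub>2) = lucas (A + D) (B * C - A * D) k" for k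
    by (intro binet_lucas) auto
  have sums: "lucas (A + D) (B * C - A * D) n = (\<Sum>j | int j \<le> \<lfloor>(real n - 1) / 2\<rfloor>.
      of_nat ((n - j - 1) choose j) * (A + D)^(n - 2*j - 1) * (B*C - A*D)^j)"
    "lucas (A + D) (B * C - A * D) (n - 1) = (\<Sum>j | int j \<le> \<lfloor>(real n - 2) / 2\<rfloor>.
      of_nat ((n - j - 2) choose j) * (A + D)^(n - 2*j - 2) * (B*C - A*D)^j)"
    unfolding lucas_eq_sum sum_index_sets by (simp_all add: numeral_2_eq_2)
  show ?thesis
    unfolding binet sums[symmetric] using tutte by simp
qed

end
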